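(* Let two collections of locally irreducible plane curve singularity types be given by their multiplicity sequences $$[n^{(1)}_1,\dots,n^{(1)}_{r_1}],\dots,[n^{(\nu)}_1,\dots,n^{(\nu)}_{r_\nu}]\quad\text{and}\quad[\overline n^{(1)}_1,\dots,\overline n^{(1)}_{\overline r_1}],\dots,[\overline n^{(\overline\nu)}_1,\dots,\overline n^{(\overline\nu)}_{\overline r_{\overline\nu}}],$$ and denote the counting functions of their semigroups by $H_1,\dots,H_\nu$ and $\overline H_1,\dots,\overline H_{\overline\nu}$, respectively. If $$\{\{n^{(1)}_1,\dots,n^{(1)}_{r_1},\dots,n^{(\nu)}_1,\dots,n^{(\nu)}_{r_\nu}\}\}=\{\{\overline n^{(1)}_1,\dots,\overline n^{(1)}_{\overline r_1},\dots,\overline n^{(\overline\nu)}_1,\dots,\overline n^{(\overline\nu)}_{\overline r_{\overline\nu}}\}\}$$ as multisets, then $$H_1\diamond\cdots\diamond H_\nu=\overline H_1\diamond\cdots\diamond\overline H_{\overline\nu}.$$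
   Context: The multiplicity sequence of a locally irreducible plane curve singularity is the non-increasing sequence of multiplicities of its successive strict transforms under blow-up, with the $1$'s at the end omitted (so all entries are $>1$); it determines the local topological type. The semigroup $\Gamma\subset\mathbb{Z}_{\ge0}$ of the singularity is the set of its intersection multiplicities with curve germs not containing it, and its counting function is $k\mapsto\#\{s\in\Gamma:s<k\}$, $k\in\mathbb{Z}$. For functions $G_1,G_2$ defined on the integers and bounded from below, the minimum convolution is $(G_1\diamond G_2)(j)=\min_{j_1+j_2=j}\{G_1(j_1)+G_2(j_2)\}$ (with $j_1,j_2\in\mathbb{Z}$); it is associative and commutative. A multiset, written $\{\{\dots\}\}$, records elements with their numbers of appearances. *)

theory Defs
  imports Complex_Main "HOL-Computational_Algebra.Computational_Algebra" "HOL-Library.Multiset"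
begin

text \<open>
  Curve germs at the origin of the complex plane are given by equations in the power series ring
  in two variables \<open>x\<close> and \<open>y\<close>, realised as series in \<open>x\<close> over the series in \<open>y\<close>:
  the coefficient of \<open>x\<^sup>i y\<^sup>j\<close> in \<open>f\<close> is \<open>f $ i $ j\<close>, the series \<open>x\<close> is \<^term>\<open>fps_X\<close>,
  and \<open>y\<close> is \<^term>\<open>fps_const fps_X\<close>.  A locally irreducible germ is one whose equation is
  \<^const>\<open>irreducible\<close> in this ring.
\<close>

type_synonym germ = "complex fps fps"

definition germ_mult :: "germ \<Rightarrow> nat" where
  "germ_mult f = (LEAST n. \<exists>i j. i + j = n \<and> f $ i $ j \<noteq> 0)"

text \<open>
  The points of the exceptional divisor are the tangent directions \<open>(1 : c)\<close> and \<open>(0 : 1)\<close>.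
  Centred at these points, the blow-up is \<open>(x, y) \<mapsto> (x, x (y + c))\<close> with exceptional divisor
  \<open>x = 0\<close>, respectively \<open>(x, y) \<mapsto> (x y, y)\<close> with exceptional divisor \<open>y = 0\<close>.
  The two series below are \<open>f (x, x (y + c))\<close> and \<open>f (x y, y)\<close>.
\<close>

definition total_transform :: "complex \<Rightarrow> germ \<Rightarrow> germ" where
  "total_transform c f =
     Abs_fps (\<lambda>k. \<Sum>j\<le>k. fps_const (f $ (k - j) $ j) * (fps_X + fps_const c) ^ j)"

definition total_transform_inf :: "germ \<Rightarrow> germ" where
  "total_transform_inf f = Abs_fps (\<lambda>i. Abs_fps (\<lambda>k. if i \<le> k then f $ i $ (k - i) else 0))"

text \<open>
  \<open>g\<close> is the germ of the strict transform of \<open>f\<close> at a point of the exceptional divisor through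
  which the strict transform passes (for irreducible \<open>f\<close> there is exactly one such point).
\<close>

definition strict_transform :: "germ \<Rightarrow> germ \<Rightarrow> bool" where
  "strict_transform f g \<longleftrightarrow> g $ 0 $ 0 = 0 \<and>
     ((\<exists>c. total_transform c f = fps_X ^ germ_mult f * g) \<or>
      total_transform_inf f = (fps_const fps_X) ^ germ_mult f * g)"

definition has_multiplicity_sequence :: "germ \<Rightarrow> nat list \<Rightarrow> bool" where
  "has_multiplicity_sequence f ns \<longleftrightarrow>
     (\<exists>F. F 0 = f \<and> (\<forall>i. strict_transform (F i) (F (Suc i))) \<and>
          (\<forall>i < length ns. germ_mult (F i) = ns ! i \<and> ns ! i > 1) \<and>
          (\<forall>i \<ge> length ns. germ_mult (F i) = 1))"

definition germ_scale :: "complex \<Rightarrow> germ \<Rightarrow> germ" where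
  "germ_scale a f = fps_const (fps_const a) * f"

text \<open>The classes of \<open>b 0, \<dots>, b (n - 1)\<close> form a basis of the complex vector space
  of power series modulo \<open>I\<close>.\<close>

definition quotient_basis :: "germ set \<Rightarrow> nat \<Rightarrow> (nat \<Rightarrow> germ) \<Rightarrow> bool" where
  "quotient_basis I n b \<longleftrightarrow>
     (\<forall>h. \<exists>a. h - (\<Sum>i<n. germ_scale (a i) (b i)) \<in> I) \<and>
     (\<forall>a. (\<Sum>i<n. germ_scale (a i) (b i)) \<in> I \<longrightarrow> (\<forall>i<n. a i = 0))"

text \<open>The dimension of the quotient by the ideal \<open>(f, g)\<close>; it is finite if \<open>f\<close> is irreducible
  and does not divide \<open>g\<close>.\<close>

definition intersection_mult :: "germ \<Rightarrow> germ \<Rightarrow> nat" where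
  "intersection_mult f g = (THE n. \<exists>b. quotient_basis {u * f + v * g |u v. True} n b)"

definition semigroup_of :: "germ \<Rightarrow> nat set" where
  "semigroup_of f = {intersection_mult f g |g. \<not> f dvd g}"

definition counting_function :: "germ \<Rightarrow> int \<Rightarrow> int" where
  "counting_function f k = int (card {s \<in> semigroup_of f. int s < k})"

text \<open>For functions bounded from below this infimum of integers is attained.\<close>

definition min_conv :: "(int \<Rightarrow> int) \<Rightarrow> (int \<Rightarrow> int) \<Rightarrow> int \<Rightarrow> int" (infixl "\<diamondop>" 65) where
  "(G1 \<diamondop> G2) j = Inf {G1 j1 + G2 j2 |j1 j2. j1 + j2 = j}"

text \<open>Meaningful for nonempty lists only.\<close>

definition min_conv_list :: "(int \<Rightarrow> int) list \<Rightarrow> int \<Rightarrow> int" where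
  "min_conv_list Gs = foldl (\<diamondop>) (hd Gs) (tl Gs)"

end

theory Submission
  imports Defs
begin

text \<open>
  The counting function of the semigroup of an irreducible germ \<open>f\<close> has an intrinsic meaning: its
  value \<open>H k\<close> is the number of linear conditions that \<open>I(f, g) \<ge> k\<close> imposes on \<open>g\<close>, the codimension
  of a valuation ideal.  Let \<open>n\<^sub>1, n\<^sub>2, \<dots>\<close> be the multiplicities of \<open>f\<close> at its infinitely near
  points, ending in ones.  A germ \<open>g\<close> with multiplicity \<open>m\<^sub>i\<close> at the \<open>i\<close>-th point has
  \<open>I(f, g) = \<Sum> n\<^sub>i m\<^sub>i\<close>, and multiplicity \<open>m\<close> at a point costs \<open>m (m + 1) / 2\<close> conditions.  The
  cheapest way to reach \<open>k\<close> is optimal: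
    \<open>H k = min {\<Sum> m\<^sub>i (m\<^sub>i + 1) / 2 | \<Sum> n\<^sub>i m\<^sub>i \<ge> k}\<close>.
  With \<open>T\<^sub>n j = min {m (m + 1) / 2 | n m \<ge> j}\<close> for a point of multiplicity \<open>n\<close>, and with
  \<open>P j = max 0 j\<close> for the infinitely many points of multiplicity one, this says that
  \<open>H = T\<^sub>n\<^sub>1 \<diamondop> \<dots> \<diamondop> T\<^sub>n\<^sub>r \<diamondop> P\<close> (lemma \<open>counting_function_eq\<close>).  As \<open>P \<diamondop> P = P\<close>, the convolution of
  the counting functions of several germs is the convolution of one \<open>T\<^sub>n\<close> for every entry \<open>n\<close> of
  their multiplicity sequences with a single \<open>P\<close>, and it depends on the multiset of entries only.

  The formula follows by induction from a single blow-up with multiplicity \<open>n\<close>, where it reads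
  \<open>H k = min\<^sub>m (m (m + 1) / 2 + H' (k - n m))\<close> (lemmas \<open>order_count_le\<close> and \<open>order_count_attained\<close>).
  Germs of multiplicity at least \<open>m\<close> form an ideal of codimension \<open>m (m + 1) / 2\<close>, and on it
  \<open>I(f, g) = n m + I(f', g')\<close> with \<open>g' = g(x, x (y + c)) / x\<^sup>m\<close>, which gives one inequality for every
  \<open>m\<close>.  Equality holds when \<open>m\<close> is the least multiplicity of a germ \<open>g\<^sub>0\<close> with \<open>I(f, g\<^sub>0) \<ge> k\<close>.
  Indeed \<open>g\<^sub>0'\<close> meets the exceptional divisor \<open>x = 0\<close> with multiplicity at most \<open>m\<close>, so Weierstrass
  division by \<open>g\<^sub>0'\<close> makes every series \<open>h\<close> congruent to a polynomial in \<open>y\<close> of degree less than \<open>m\<close>;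
  and \<open>x\<^sup>m\<close> times such a polynomial is the total transform of a germ.  Hence every value below
  \<open>k - n m\<close> of the semigroup of \<open>f'\<close> comes from a germ of multiplicity at least \<open>m\<close>.

  Intersection multiplicities are handled through parametrisations \<open>\<phi>\<close>, homomorphisms to the power
  series in one variable whose image contains all series of large order.  If \<open>f\<close> generates the
  kernel of \<open>\<phi>\<close> then \<open>I(f, g)\<close> is the order of \<open>\<phi> g\<close> (lemma \<open>intersection_mult_eq\<close>).  The smooth germ
  at the end of the multiplicity sequence has a parametrisation, and composing it with the blow-ups
  gives one of \<open>f\<close>.
\<close>

section \<open>Dimensions of quotients of vector spaces\<close>

locale vector_space_quotients = vector_space scale
  for scale :: "'a::field \<Rightarrow> 'b::ab_group_add \<Rightarrow> 'b" (infixr "*s" 75)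
begin

definition basis_modulo :: "'b set \<Rightarrow> 'b set \<Rightarrow> 'i set \<Rightarrow> ('i \<Rightarrow> 'b) \<Rightarrow> bool" where
  "basis_modulo W V I b \<longleftrightarrow> (\<forall>i\<in>I. b i \<in> W) \<and>
     (\<forall>w\<in>W. \<exists>a. w - (\<Sum>i\<in>I. a i *s b i) \<in> V) \<and>
     (\<forall>a. (\<Sum>i\<in>I. a i *s b i) \<in> V \<longrightarrow> (\<forall>i\<in>I. a i = 0))"

text \<open>
  Replacing every \<open>c j\<close> by a linear combination of the \<open>b i\<close> that is congruent to it modulo \<open>V\<close> keeps
  the family independent, and now it lies in the span of the \<open>b i\<close>.
\<close>

lemma independent_modulo_card_le:
  fixes b :: "'i \<Rightarrow> 'b" and c :: "'j \<Rightarrow> 'b"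
  assumes V: "subspace V" and fin: "finite I" "finite J"
    and spanning: "\<And>w. w \<in> W \<Longrightarrow> \<exists>a. w - (\<Sum>i\<in>I. a i *s b i) \<in> V"
    and cW: "\<And>j. j \<in> J \<Longrightarrow> c j \<in> W"
    and indep: "\<And>a. (\<Sum>j\<in>J. a j *s c j) \<in> V \<Longrightarrow> \<forall>j\<in>J. a j = 0"
  shows "card J \<le> card I"
proof -
  have "\<forall>j\<in>J. \<exists>a. c j - (\<Sum>i\<in>I. a i *s b i) \<in> V"
    using spanning cW by blast
  then obtain A where A: "\<forall>j\<in>J. c j - (\<Sum>i\<in>I. A j i *s b i) \<in> V"
    by metis
  define c' where "c' = (\<lambda>j. \<Sum>i\<in>I. A j i *s b i)"
  have c': "c j - c' j \<in> V" if "j \<in> J" for j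
    using A that by (simp add: c'_def)
  have indep': "\<forall>j\<in>J. a j = 0" if "(\<Sum>j\<in>J. a j *s c' j) = 0" for a
  proof (rule indep)
    have "(\<Sum>j\<in>J. a j *s c j) = (\<Sum>j\<in>J. a j *s (c j - c' j))"
      using that by (simp add: scale_right_diff_distrib sum_subtractf)
    also have "\<dots> \<in> V"
      by (intro subspace_sum[OF V] subspace_scale[OF V] c')
    finally show "(\<Sum>j\<in>J. a j *s c j) \<in> V" .
  qed
  have inj: "inj_on c' J"
  proof (rule inj_onI, rule ccontr)
    fix j k assume jk: "j \<in> J" "k \<in> J" "c' j = c' k" "j \<noteq> k"
    define a where "a = (\<lambda>i. if i = j then 1 else if i = k then - 1 else (0::'a))"
    have "(\<Sum>i\<in>J. a i *s c' i) = (\<Sum>i\<in>{j,k}. a i *s c' i)"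
      by (rule sum.mono_neutral_right) (use fin jk in \<open>auto simp: a_def\<close>)
    also have "\<dots> = 0"
      using jk by (simp add: a_def)
    finally have "\<forall>i\<in>J. a i = 0" by (rule indep')
    then show False using jk by (auto simp: a_def)
  qed
  have "independent (c' ` J)"
  proof
    assume "dependent (c' ` J)"
    then obtain u v where u: "v \<in> c' ` J" "u v \<noteq> 0" "(\<Sum>v\<in>c' ` J. u v *s v) = 0"
      using dependent_finite[of "c' ` J"] fin by auto
    then have "(\<Sum>j\<in>J. u (c' j) *s c' j) = 0"
      by (simp add: sum.reindex[OF inj])
    from indep'[OF this] u show False by auto
  qed
  moreover have "c' ` J \<subseteq> span (b ` I)"
    by (auto simp: c'_def intro!: span_sum span_scale intro: span_base)
  ultimately have "card (c' ` J) \<le> card (b ` I)"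
    using independent_span_bound fin by blast
  then show ?thesis
    using card_image[OF inj] card_image_le[OF fin(1), of b] by simp
qed

definition has_quotient_dim :: "'b set \<Rightarrow> 'b set \<Rightarrow> nat \<Rightarrow> bool" where
  "has_quotient_dim W V n \<longleftrightarrow> (\<exists>b. basis_modulo W V {..<n} b)"

lemma has_quotient_dimI:
  assumes b: "basis_modulo W V I b" and I: "finite I"
  shows "has_quotient_dim W V (card I)"
proof -
  obtain h where h: "bij_betw h {..<card I} I"
    using ex_bij_betw_nat_finite[OF I] by (auto simp: atLeast0LessThan)
  have reindex: "(\<Sum>i<card I. a (h i) *s b (h i)) = (\<Sum>i\<in>I. a i *s b i)" for a
    using sum.reindex_bij_betw[OF h, of "\<lambda>i. a i *s b i"] .
  have "basis_modulo W V {..<card I} (b \<circ> h)"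
    unfolding basis_modulo_def
  proof (intro conjI ballI allI impI)
    fix i assume "i \<in> {..<card I}"
    then show "(b \<circ> h) i \<in> W"
      using b h by (auto simp: basis_modulo_def bij_betw_def)
  next
    fix w assume "w \<in> W"
    then obtain a where "w - (\<Sum>i\<in>I. a i *s b i) \<in> V"
      using b by (auto simp: basis_modulo_def)
    then show "\<exists>a. w - (\<Sum>i<card I. a i *s (b \<circ> h) i) \<in> V"
      by (intro exI[of _ "a \<circ> h"]) (simp add: reindex)
  next
    fix a i assume a: "(\<Sum>i<card I. a i *s (b \<circ> h) i) \<in> V" and i: "i \<in> {..<card I}"
    define a' where "a' = a \<circ> the_inv_into {..<card I} h"
    have a': "a' (h i) = a i" if "i < card I" for i
      using that h by (simp add: a'_def bij_betw_def the_inv_into_f_f)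
    have "(\<Sum>i\<in>I. a' i *s b i) = (\<Sum>i<card I. a i *s (b \<circ> h) i)"
      unfolding reindex[symmetric] by (rule sum.cong) (simp_all add: a')
    with a have "\<forall>i\<in>I. a' i = 0"
      using b by (auto simp: basis_modulo_def)
    then show "a i = 0"
      using a' i h by (force simp: bij_betw_def)
  qed
  then show ?thesis
    by (auto simp: has_quotient_dim_def)
qed

lemma has_quotient_dim_antimono:
  assumes "has_quotient_dim W V n" "has_quotient_dim W U p" "U \<subseteq> V" "subspace V"
  shows "n \<le> p"
proof -
  obtain b c where b: "basis_modulo W V {..<n} b" and c: "basis_modulo W U {..<p} c"
    using assms by (auto simp: has_quotient_dim_def)
  have "card {..<n} \<le> card {..<p}"
  proof (rule independent_modulo_card_le[where W = W and V = V and b = c and c = b])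
    show "\<exists>a. w - (\<Sum>i<p. a i *s c i) \<in> V" if "w \<in> W" for w
      using that c assms(3) unfolding basis_modulo_def by blast
    show "\<forall>i\<in>{..<n}. a i = 0" if "(\<Sum>i<n. a i *s b i) \<in> V" for a
      using that b by (auto simp: basis_modulo_def)
    show "b j \<in> W" if "j \<in> {..<n}" for j
      using that b by (simp add: basis_modulo_def)
  qed (simp_all add: assms(4))
  then show ?thesis by simp
qed

lemma has_quotient_dim_unique:
  assumes "has_quotient_dim W V n" "has_quotient_dim W V p" "subspace V"
  shows "n = p"
  using has_quotient_dim_antimono[OF _ _ order.refl assms(3)] assms(1,2) by (blast intro: order.antisym)

lemma has_quotient_dim_add:
  assumes W: "has_quotient_dim W V n" and V: "has_quotient_dim V U p"
    and sub: "subspace V" "U \<subseteq> V" "V \<subseteq> W"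
  shows "has_quotient_dim W U (n + p)"
proof -
  obtain b c where b: "basis_modulo W V {..<n} b" and c: "basis_modulo V U {..<p} c"
    using assms by (auto simp: has_quotient_dim_def)
  have split: "(\<Sum>i\<in>{..<n} <+> {..<p}. a i *s case_sum b c i) =
      (\<Sum>i<n. a (Inl i) *s b i) + (\<Sum>i<p. a (Inr i) *s c i)" for a
    by (subst sum.Plus) auto
  have cV: "(\<Sum>i<p. a i *s c i) \<in> V" for a
    by (intro subspace_sum subspace_scale sub) (use c in \<open>auto simp: basis_modulo_def\<close>)
  have "basis_modulo W U ({..<n} <+> {..<p}) (case_sum b c)"
    unfolding basis_modulo_def
  proof (intro conjI ballI allI impI)
    fix i assume "i \<in> {..<n} <+> {..<p}"
    then show "case_sum b c i \<in> W"
      using b c sub by (auto simp: basis_modulo_def)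
  next
    fix w assume "w \<in> W"
    then obtain a where "w - (\<Sum>i<n. a i *s b i) \<in> V"
      using b by (auto simp: basis_modulo_def)
    then obtain a' where "w - (\<Sum>i<n. a i *s b i) - (\<Sum>i<p. a' i *s c i) \<in> U"
      using c unfolding basis_modulo_def by blast
    then show "\<exists>a. w - (\<Sum>i\<in>{..<n} <+> {..<p}. a i *s case_sum b c i) \<in> U"
      by (intro exI[of _ "case_sum a a'"]) (simp only: split sum.case diff_diff_eq)
  next
    fix a i assume a: "(\<Sum>i\<in>{..<n} <+> {..<p}. a i *s case_sum b c i) \<in> U"
      and i: "i \<in> {..<n} <+> {..<p}"
    have "(\<Sum>i<n. a (Inl i) *s b i) \<in> V"
      using a subspace_diff[OF sub(1) _ cV[of "\<lambda>i. a (Inr i)"]] sub(2)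
      by (fastforce simp: split)
    then have l: "\<forall>i<n. a (Inl i) = 0"
      using b by (auto simp: basis_modulo_def dest: spec[of _ "\<lambda>i. a (Inl i)"])
    with a have "(\<Sum>i<p. a (Inr i) *s c i) \<in> U"
      by (simp add: split)
    then have "\<forall>i<p. a (Inr i) = 0"
      using c by (auto simp: basis_modulo_def dest: spec[of _ "\<lambda>i. a (Inr i)"])
    with l i show "a i = 0" by auto
  qed
  from has_quotient_dimI[OF this] show ?thesis
    by (simp add: card_Plus)
qed

end

interpretation germ: vector_space_quotients germ_scale
  by unfold_locales (simp_all only: germ_scale_def fps_const_add[symmetric] fps_const_mult[symmetric]
    distrib_left distrib_right mult.assoc fps_const_1_eq_1 mult_1_left)

lemma quotient_basis_iff: "quotient_basis I n b \<longleftrightarrow> germ.basis_modulo UNIV I {..<n} b"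
  by (simp add: quotient_basis_def germ.basis_modulo_def Ball_def)

lemma nth_eq_0_below_iff: "h \<noteq> 0 \<Longrightarrow> (\<forall>i<M. h $ i = 0) \<longleftrightarrow> M \<le> subdegree (h :: complex fps)"
  by (auto intro: subdegree_geI nth_less_subdegree_zero order_less_le_trans)

section \<open>Dimensions from sets of orders\<close>

definition orders :: "(germ \<Rightarrow> complex fps) \<Rightarrow> germ set \<Rightarrow> nat set" where
  "orders \<phi> W = {subdegree (\<phi> g) |g. g \<in> W \<and> \<phi> g \<noteq> 0}"

text \<open>
  Gaussian elimination with respect to the order: one vector of \<open>W\<close> for every order that occurs in
  \<open>W\<close> but not in \<open>V\<close> gives a basis modulo \<open>V\<close>.  These vectors span because leading terms can be
  removed until the order is at least \<open>M\<close>; they are independent because a combination that is not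
  trivial has the order of one of its terms, which is not an order of an element of \<open>V\<close>.
\<close>

lemma has_quotient_dim_orders:
  assumes W: "germ.subspace W" and V: "germ.subspace V" "V \<subseteq> W"
    and add: "\<And>g h. \<phi> (g + h) = \<phi> g + \<phi> h"
    and scale: "\<And>a g. \<phi> (germ_scale a g) = fps_const a * \<phi> g"
    and conductor: "\<And>g. g \<in> W \<Longrightarrow> \<forall>i<M. \<phi> g $ i = 0 \<Longrightarrow> g \<in> V"
  shows "germ.has_quotient_dim W V (card (orders \<phi> W - orders \<phi> V))"
proof -
  let ?D = "orders \<phi> W - orders \<phi> V"
  have lin: "additive \<phi>" by unfold_locales (rule add)
  have phi_diff: "\<phi> (g - h) = \<phi> g - \<phi> h" for g h
    using additive.diff[OF lin] .
  have "\<exists>g\<in>W. \<phi> g \<noteq> 0 \<and> subdegree (\<phi> g) = s" if "s \<in> ?D" for s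
    using that by (auto simp: orders_def)
  then obtain b where b: "\<And>s. s \<in> ?D \<Longrightarrow> b s \<in> W \<and> \<phi> (b s) \<noteq> 0 \<and> subdegree (\<phi> (b s)) = s"
    by metis
  have bound: "s < M" if s: "s \<in> ?D" for s
  proof (rule ccontr)
    assume "\<not> s < M"
    then have "b s \<in> V"
      using b[OF s] by (intro conductor) (auto simp: nth_eq_0_below_iff)
    then have "s \<in> orders \<phi> V"
      using b[OF s] by (force simp: orders_def)
    with s show False by simp
  qed
  then have fin: "finite ?D"
    by (meson bounded_nat_set_is_finite)
  have phi_sum: "\<phi> (\<Sum>s\<in>?D. germ_scale (a s) (b s)) = (\<Sum>s\<in>?D. fps_const (a s) * \<phi> (b s))" for a
    by (simp add: additive.sum[OF lin] scale)
  have "germ.basis_modulo W V ?D b"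
    unfolding germ.basis_modulo_def
  proof (intro conjI ballI allI impI)
    fix s assume "s \<in> ?D" then show "b s \<in> W" using b by blast
  next
    have "\<exists>a. w - (\<Sum>i\<in>?D. germ_scale (a i) (b i)) \<in> V"
      if "w \<in> W" "\<forall>i<M - d. \<phi> w $ i = 0" for w d
      using that
    proof (induction d arbitrary: w)
      case 0
      then show ?case
        using conductor[of w] by (intro exI[of _ "\<lambda>_. 0"]) simp
    next
      case (Suc d)
      define s where "s = M - Suc d"
      show ?case
      proof (cases "\<phi> w $ s = 0 \<or> M \<le> d")
        case True
        have "\<forall>i<M - d. \<phi> w $ i = 0"
        proof (intro allI impI)
          fix i assume "i < M - d"
          then have "i < M - Suc d \<or> i = s" "\<not> M \<le> d" by (auto simp: s_def)
          then show "\<phi> w $ i = 0" using Suc.prems True by auto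
        qed
        with Suc show ?thesis by blast
      next
        case False
        then have nz: "\<phi> w \<noteq> 0" and sd: "subdegree (\<phi> w) = s"
          using Suc.prems by (auto simp: s_def intro!: subdegreeI)
        \<comment> \<open>An element with the same order, whose multiple cancels the leading term.\<close>
        have cancel: "\<forall>i<M - d. \<phi> (w - germ_scale (\<phi> w $ s / \<phi> v $ s) v) $ i = 0"
          if "\<phi> v \<noteq> 0" "subdegree (\<phi> v) = s" for v
        proof (intro allI impI)
          fix i assume "i < M - d"
          then have "i < s \<or> i = s" by (auto simp: s_def)
          moreover have "\<phi> v $ s \<noteq> 0" using that nth_subdegree_nonzero[of "\<phi> v"] by simp
          moreover have "\<phi> w $ i = 0" if "i < s"
            using that Suc.prems(2) unfolding s_def by blast
          moreover have "\<phi> v $ i = 0" if "i < s"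
            using that \<open>subdegree (\<phi> v) = s\<close> nth_less_subdegree_zero by blast
          moreover have "\<phi> (w - germ_scale (\<phi> w $ s / \<phi> v $ s) v) $ i =
              \<phi> w $ i - \<phi> w $ s / \<phi> v $ s * \<phi> v $ i"
            by (simp only: phi_diff scale fps_sub_nth fps_mult_left_const_nth)
          ultimately show "\<phi> (w - germ_scale (\<phi> w $ s / \<phi> v $ s) v) $ i = 0"
            by auto
        qed
        show ?thesis
        proof (cases "s \<in> orders \<phi> V")
          case True
          then obtain v where v: "v \<in> V" "\<phi> v \<noteq> 0" "subdegree (\<phi> v) = s"
            by (auto simp: orders_def)
          let ?v = "germ_scale (\<phi> w $ s / \<phi> v $ s) v"
          have "?v \<in> V" "w - ?v \<in> W"
            using v V W Suc.prems by (auto intro!: germ.subspace_scale germ.subspace_diff)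
          with Suc.IH[OF _ cancel[OF v(2,3)]]
          obtain a where "w - ?v - (\<Sum>i\<in>?D. germ_scale (a i) (b i)) \<in> V"
            by blast
          from germ.subspace_add[OF V(1) this \<open>?v \<in> V\<close>] show ?thesis
            by (auto simp: algebra_simps)
        next
          case False
          with nz sd Suc.prems have s: "s \<in> ?D"
            by (force simp: orders_def)
          let ?c = "\<phi> w $ s / \<phi> (b s) $ s"
          have "w - germ_scale ?c (b s) \<in> W"
            using b[OF s] W Suc.prems by (auto intro!: germ.subspace_scale germ.subspace_diff)
          with Suc.IH[OF _ cancel] b[OF s]
          obtain a where a: "w - germ_scale ?c (b s) - (\<Sum>i\<in>?D. germ_scale (a i) (b i)) \<in> V"
            by blast
          have "(\<Sum>i\<in>?D. germ_scale ((a(s := a s + ?c)) i) (b i)) =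
              (\<Sum>i\<in>?D. germ_scale (a i) (b i) + (if i = s then germ_scale ?c (b s) else 0))"
            by (rule sum.cong) (auto simp: germ.scale_left_distrib)
          also have "\<dots> = (\<Sum>i\<in>?D. germ_scale (a i) (b i)) + germ_scale ?c (b s)"
            using fin s by (simp add: sum.distrib)
          finally have "w - (\<Sum>i\<in>?D. germ_scale ((a(s := a s + ?c)) i) (b i)) \<in> V"
            using a by (simp add: algebra_simps)
          then show ?thesis by blast
        qed
      qed
    qed
    from this[of _ M] show "\<exists>a. w - (\<Sum>i\<in>?D. germ_scale (a i) (b i)) \<in> V" if "w \<in> W" for w
      using that by simp
  next
    fix a s assume a: "(\<Sum>s\<in>?D. germ_scale (a s) (b s)) \<in> V" and s: "s \<in> ?D"
    show "a s = 0"
    proof (rule ccontr)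
      assume "a s \<noteq> 0"
      define m where "m = (LEAST s. s \<in> ?D \<and> a s \<noteq> 0)"
      have m: "m \<in> ?D" "a m \<noteq> 0"
        using LeastI[of "\<lambda>s. s \<in> ?D \<and> a s \<noteq> 0" s] s \<open>a s \<noteq> 0\<close> by (auto simp: m_def)
      have min: "m \<le> s" if "s \<in> ?D" "a s \<noteq> 0" for s
        using that by (auto simp: m_def intro: Least_le)
      let ?w = "\<Sum>s\<in>?D. germ_scale (a s) (b s)"
      have low: "(fps_const (a s) * \<phi> (b s)) $ i = 0" if "s \<in> ?D" "i < m \<or> i = m \<and> s \<noteq> m" for s i
      proof (cases "a s = 0")
        case False
        from b[OF that(1)] have "subdegree (\<phi> (b s)) = s" by blast
        moreover have "i < s"
          using min[OF that(1) False] that(2) by linarith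
        ultimately have "i < subdegree (\<phi> (b s))" by simp
        then have "\<phi> (b s) $ i = 0" by (rule nth_less_subdegree_zero)
        then show ?thesis by simp
      qed simp
      have "\<phi> ?w $ i = (\<Sum>s\<in>?D. (fps_const (a s) * \<phi> (b s)) $ i)" for i
        by (simp add: phi_sum fps_sum_nth)
      moreover have "(\<Sum>s\<in>?D. (fps_const (a s) * \<phi> (b s)) $ i) = 0" if "i < m" for i
        using that low by (intro sum.neutral) blast
      moreover have "(\<Sum>s\<in>?D. (fps_const (a s) * \<phi> (b s)) $ m) = a m * \<phi> (b m) $ m"
        using sum.remove[OF fin m(1), of "\<lambda>s. (fps_const (a s) * \<phi> (b s)) $ m"] low
        by (simp add: sum.neutral)
      moreover have "\<phi> (b m) $ m \<noteq> 0"
        using b[OF m(1)] nth_subdegree_nonzero[of "\<phi> (b m)"] by simp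
      ultimately have "\<phi> ?w $ m \<noteq> 0" "\<And>i. i < m \<Longrightarrow> \<phi> ?w $ i = 0"
        using m by auto
      then have "\<phi> ?w \<noteq> 0 \<and> subdegree (\<phi> ?w) = m"
        by (auto intro!: subdegreeI)
      with a have "m \<in> orders \<phi> V" by (force simp: orders_def)
      with m show False by simp
    qed
  qed
  then show ?thesis
    using fin by (rule germ.has_quotient_dimI)
qed

section \<open>Units and orders of power series\<close>

lemma fps_unit_iff_nth_0: "(h :: 'a::comm_ring_1 fps) dvd 1 \<longleftrightarrow> h $ 0 dvd 1"
proof
  assume "h dvd 1"
  then obtain k where "1 = h * k" by (auto elim: dvdE)
  then have "1 = h $ 0 * k $ 0" by (metis fps_mult_nth_0 fps_one_nth)
  then show "h $ 0 dvd 1" by (metis dvd_triv_left)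
next
  assume "h $ 0 dvd 1"
  then obtain y where "h $ 0 * y = 1" by (auto elim: dvdE)
  then have "h * fps_right_inverse h y = 1" by (rule fps_right_inverse)
  then show "h dvd 1" by (metis dvd_triv_left)
qed

lemma germ_unit_iff: "(h :: germ) dvd 1 \<longleftrightarrow> h $ 0 $ 0 \<noteq> 0"
  by (simp add: fps_unit_iff_nth_0 dvd_field_iff)

lemma fps_X_power_subdegree:
  fixes h :: "'a::field fps"
  assumes "h \<noteq> 0"
  shows "fps_X ^ subdegree h = h * inverse (fps_shift (subdegree h) h)"
proof -
  let ?u = "fps_shift (subdegree h) h"
  have "h * inverse ?u = fps_X ^ subdegree h * (?u * inverse ?u)"
    using subdegree_decompose[of h] by (metis mult.commute mult.left_commute)
  then show ?thesis
    using assms by (simp add: inverse_mult_eq_1')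
qed

section \<open>Weierstrass division\<close>

text \<open>
  The case of constant coefficients, where the divisor is a power of the variable times a unit.
\<close>

lemma fps_division_by_order:
  fixes h p :: "'a::field fps"
  assumes "p \<noteq> 0"
  shows "\<exists>q. \<forall>j\<ge>subdegree p. (h - q * p) $ j = 0"
proof -
  define d u where "d = subdegree p" and "u = fps_shift d p"
  have u0: "u $ 0 \<noteq> 0"
    using assms by (simp add: u_def d_def)
  have p: "p = u * fps_X ^ d"
    using subdegree_decompose[of p] by (simp add: u_def d_def)
  have "fps_shift d h * inverse u * p = fps_shift d h * (inverse u * u) * fps_X ^ d"
    by (simp add: p mult.assoc)
  also have "\<dots> = fps_shift d h * fps_X ^ d"
    using u0 by (simp add: inverse_mult_eq_1)
  finally have "(h - fps_shift d h * inverse u * p) $ j = (h - fps_shift d h * fps_X ^ d) $ j" for j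
    by (simp only:)
  then show ?thesis
    unfolding d_def[symmetric]
    by (intro exI[of _ "fps_shift d h * inverse u"]) (simp only:, simp add: fps_X_power_mult_right_nth)
qed

definition order_quotient :: "'a::field fps \<Rightarrow> 'a fps \<Rightarrow> 'a fps" where
  "order_quotient p h = (SOME q. \<forall>j\<ge>subdegree p. (h - q * p) $ j = 0)"

lemma order_quotient: "p \<noteq> 0 \<Longrightarrow> subdegree p \<le> j \<Longrightarrow> (h - order_quotient p h * p) $ j = 0"
  using someI_ex[OF fps_division_by_order[of p h]] by (simp add: order_quotient_def)

text \<open>
  The quotient is found coefficient by coefficient in \<open>x\<close>: once the terms of lower degree are known,
  the coefficient of \<open>x\<^sup>k\<close> asks for a division by \<open>p $ 0\<close> in the power series ring in \<open>y\<close>.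
\<close>

fun weierstrass_coeff :: "'a::field fps fps \<Rightarrow> 'a fps fps \<Rightarrow> nat \<Rightarrow> 'a fps" where
  "weierstrass_coeff p g k =
     order_quotient (p $ 0) (g $ k - (\<Sum>i<k. weierstrass_coeff p g i * p $ (k - i)))"

declare weierstrass_coeff.simps [simp del]

lemma weierstrass_division:
  fixes g p :: "'a::field fps fps"
  assumes "p $ 0 \<noteq> 0"
  obtains q r where "g = q * p + r" "\<And>i j. subdegree (p $ 0) \<le> j \<Longrightarrow> r $ i $ j = 0"
proof
  define q where "q = Abs_fps (weierstrass_coeff p g)"
  show "g = q * p + (g - q * p)" by simp
  fix i j assume j: "subdegree (p $ 0) \<le> j"
  have "(q * p) $ i = (\<Sum>k<i. q $ k * p $ (i - k)) + q $ i * p $ 0"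
    by (simp add: fps_mult_nth atLeast0AtMost flip: lessThan_Suc_atMost)
  then have "(g - q * p) $ i =
      (g $ i - (\<Sum>k<i. weierstrass_coeff p g k * p $ (i - k))) - q $ i * p $ 0"
    by (simp add: q_def)
  also have "q $ i = order_quotient (p $ 0) (g $ i - (\<Sum>k<i. weierstrass_coeff p g k * p $ (i - k)))"
    by (simp add: q_def weierstrass_coeff.simps[of p g i])
  finally show "(g - q * p) $ i $ j = 0"
    using order_quotient[OF assms j] by (simp only:)
qed

text \<open>
  The lowest coefficient of \<open>q * p\<close> is a multiple of \<open>p $ 0\<close>, hence has order at least that of
  \<open>p $ 0\<close> in \<open>y\<close>, whereas the coefficients of \<open>r\<close> are polynomials of smaller degree.
\<close>

lemma weierstrass_division_unique:
  fixes p q r :: "'a::field fps fps"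
  assumes p: "p $ 0 \<noteq> 0" and eq: "q * p + r = 0"
    and r: "\<And>i j. subdegree (p $ 0) \<le> j \<Longrightarrow> r $ i $ j = 0"
  shows "q = 0" "r = 0"
proof -
  show "q = 0"
  proof (rule ccontr)
    assume "q \<noteq> 0"
    let ?k = "subdegree q"
    have "(q * p) $ ?k = q $ ?k * p $ 0"
      using nth_subdegree_mult[of q p] p by simp
    moreover have "(q * p) $ ?k = - r $ ?k"
      using eq by (metis add_eq_0_iff2 fps_neg_nth)
    ultimately have "r $ ?k $ j = - (q $ ?k * p $ 0) $ j" for j
      by (metis fps_neg_nth minus_minus)
    then have "(q $ ?k * p $ 0) $ j = 0" if "subdegree (p $ 0) \<le> j" for j
      using r[OF that, of ?k] by simp
    from this[of "subdegree (q $ ?k) + subdegree (p $ 0)"]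
    have zero: "(q $ ?k * p $ 0) $ (subdegree (q $ ?k) + subdegree (p $ 0)) = 0"
      using le_add2 by blast
    have "q $ ?k \<noteq> 0" using \<open>q \<noteq> 0\<close> by simp
    with zero p show False
      by (simp only: nth_subdegree_mult) simp
  qed
  with eq show "r = 0" by simp
qed

text \<open>The embedding of the series in \<open>x\<close> alone; the inner series are constant.\<close>

definition from_x :: "'a::zero fps \<Rightarrow> 'a fps fps" where
  "from_x u = Abs_fps (\<lambda>i. fps_const (u $ i))"

lemma from_x_nth [simp]: "from_x u $ i = fps_const (u $ i)"
  by (simp add: from_x_def)

lemma from_x_add: "from_x (u + v) = from_x u + from_x (v :: 'a::comm_ring_1 fps)"
  by (simp add: fps_eq_iff)

lemma fps_const_sum: "fps_const (\<Sum>i\<in>A. h i) = (\<Sum>i\<in>A. fps_const (h i :: 'a::comm_ring_1))"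
  by (induction A rule: infinite_finite_induct) (simp_all add: fps_const_add[symmetric] del: fps_const_add)

lemma from_x_mult: "from_x (u * v) = from_x u * from_x (v :: 'a::comm_ring_1 fps)"
  by (rule fps_ext) (simp add: fps_mult_nth fps_const_sum)

lemma from_x_const: "from_x (fps_const a) = fps_const (fps_const (a :: 'a::comm_ring_1))"
  by (rule fps_ext) simp

lemma expand_in_y:
  fixes r :: "'a::comm_ring_1 fps fps"
  assumes "\<And>i j. d \<le> j \<Longrightarrow> r $ i $ j = 0"
  shows "r = (\<Sum>j<d. from_x (Abs_fps (\<lambda>i. r $ i $ j)) * fps_const fps_X ^ j)"
proof (intro fps_ext)
  fix i l
  have "(\<Sum>j<d. from_x (Abs_fps (\<lambda>i. r $ i $ j)) * fps_const fps_X ^ j) $ i $ l =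
      (\<Sum>j<d. (fps_const (r $ i $ j) * fps_X ^ j) $ l)"
    by (simp add: fps_sum_nth fps_const_power del: fps_const_power[symmetric])
  also have "\<dots> = (\<Sum>j<d. if j = l then r $ i $ j else 0)"
    by (rule sum.cong) (auto simp: fps_X_power_iff)
  also have "\<dots> = r $ i $ l"
    using assms[of l i] by simp
  finally show "r $ i $ l =
      (\<Sum>j<d. from_x (Abs_fps (\<lambda>i. r $ i $ j)) * fps_const fps_X ^ j) $ i $ l" ..
qed

section \<open>Parametrisations\<close>

text \<open>
  The algebra homomorphism \<open>g \<mapsto> g (x(t), y(t))\<close> of a parametrised branch.  The conductor condition
  makes the parametrisation primitive: it excludes \<open>(t\<^sup>2, t\<^sup>4)\<close>, say, and it gives the image finite
  codimension.
\<close>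

locale parametrisation =
  fixes \<phi> :: "germ \<Rightarrow> complex fps"
  assumes add: "\<phi> (g + h) = \<phi> g + \<phi> h"
    and mult: "\<phi> (g * h) = \<phi> g * \<phi> h"
    and const: "\<phi> (fps_const (fps_const a)) = fps_const a"
    and conductor: "\<exists>N. \<forall>u. fps_X ^ N * u \<in> range \<phi>"
begin

lemma zero [simp]: "\<phi> 0 = 0"
  using const[of 0] by simp

lemma one [simp]: "\<phi> 1 = 1"
  using const[of 1] by simp

lemma diff: "\<phi> (g - h) = \<phi> g - \<phi> h"
  using add[of "g - h" h] by simp

lemma power: "\<phi> (g ^ n) = \<phi> g ^ n"
  by (induction n) (simp_all add: mult)

lemma scale: "\<phi> (germ_scale a g) = fps_const a * \<phi> g"
  by (simp add: germ_scale_def mult const)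

lemma unit: "h dvd 1 \<Longrightarrow> \<phi> h $ 0 \<noteq> 0"
proof -
  assume "h dvd 1"
  then obtain k where "1 = h * k" by (auto elim: dvdE)
  then have "\<phi> h * \<phi> k = 1" by (metis mult one)
  then show "\<phi> h $ 0 \<noteq> 0" by (metis fps_mult_nth_0 fps_one_nth mult_zero_left zero_neq_one)
qed

text \<open>Otherwise the image would consist of constants and could not contain all series of large order.\<close>

lemma coordinate_nonzero: "\<phi> fps_X \<noteq> 0 \<or> \<phi> (fps_const fps_X) \<noteq> 0"
proof (rule ccontr)
  assume "\<not> ?thesis"
  then have X: "\<phi> fps_X = 0" and Y: "\<phi> (fps_const fps_X) = 0" by auto
  have const_eq: "\<phi> g = fps_const (g $ 0 $ 0)" for g
  proof -
    have "g = fps_const (g $ 0) + fps_shift 1 g * fps_X"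
      by (rule fps_ext) auto
    moreover have "g $ 0 = fps_const (g $ 0 $ 0) + fps_shift 1 (g $ 0) * fps_X"
      by (rule fps_ext) auto
    ultimately have "g = fps_const (fps_const (g $ 0 $ 0)) +
        fps_const (fps_shift 1 (g $ 0)) * fps_const fps_X + fps_shift 1 g * fps_X"
      by (metis fps_const_add fps_const_mult)
    then show ?thesis
      by (metis X Y add mult const mult_zero_right add.right_neutral)
  qed
  obtain N g where "fps_X ^ N * fps_X = \<phi> g"
    using conductor by (metis rangeE)
  with const_eq have "(fps_X ^ Suc N :: complex fps) = fps_const (g $ 0 $ 0)"
    by (metis power_Suc2)
  then have "(fps_X ^ Suc N :: complex fps) $ Suc N = fps_const (g $ 0 $ 0) $ Suc N"
    by (rule arg_cong)
  then show False by (simp add: fps_X_power_iff del: power_Suc)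
qed

lemma kernel_fps_X:
  assumes "\<phi> fps_X = 0"
  shows "\<phi> g = 0 \<longleftrightarrow> fps_X dvd g"
proof -
  have Y: "\<phi> (fps_const fps_X) \<noteq> 0"
    using coordinate_nonzero assms by blast
  show ?thesis
  proof
    assume "\<phi> g = 0"
    have g: "g = fps_const (g $ 0) + fps_X * fps_shift 1 g"
      by (rule fps_ext) auto
    with \<open>\<phi> g = 0\<close> assms have 0: "\<phi> (fps_const (g $ 0)) = 0"
      by (metis add mult mult_zero_left add.right_neutral)
    have "g $ 0 = 0"
    proof (rule ccontr)
      assume nz: "g $ 0 \<noteq> 0"
      let ?u = "fps_shift (subdegree (g $ 0)) (g $ 0)"
      have "fps_const (g $ 0) = fps_const ?u * fps_const fps_X ^ subdegree (g $ 0)"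
        by (metis subdegree_decompose fps_const_mult fps_const_power)
      with 0 have "\<phi> (fps_const ?u) * \<phi> (fps_const fps_X) ^ subdegree (g $ 0) = 0"
        by (metis mult power)
      with Y have "\<phi> (fps_const ?u) = 0" by simp
      moreover have "\<phi> (fps_const ?u) $ 0 \<noteq> 0"
        using nz by (intro unit) (simp add: germ_unit_iff)
      ultimately show False by simp
    qed
    with g show "fps_X dvd g"
      by (metis add.left_neutral dvd_triv_left fps_const_0_eq_0)
  next
    assume "fps_X dvd g"
    with assms show "\<phi> g = 0" by (auto elim!: dvdE simp: mult)
  qed
qed

text \<open>
  Let \<open>x\<close> not lie in the kernel.  Powers of \<open>x\<close> can then be cancelled from elements of the kernel, so
  the kernel contains an element that is regular in \<open>y\<close>; one of least order \<open>d\<close> in \<open>y\<close> is a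
  generator, for the remainder of a division by it has degree less than \<open>d\<close> in \<open>y\<close> and lies in the
  kernel.
\<close>

lemma kernel_principal:
  assumes "f \<noteq> 0" "\<phi> f = 0"
  obtains p where "\<And>g. \<phi> g = 0 \<longleftrightarrow> p dvd g"
proof (cases "\<phi> fps_X = 0")
  case True
  then show ?thesis using that kernel_fps_X by blast
next
  case False
  have strip: "\<phi> (fps_shift (subdegree h) h) = 0" if "\<phi> h = 0" for h
  proof -
    have "\<phi> (fps_shift (subdegree h) h) * \<phi> fps_X ^ subdegree h = 0"
      using that by (metis subdegree_decompose mult power)
    with False show ?thesis by simp
  qed
  define P where "P = (\<lambda>g. \<phi> g = 0 \<and> g $ 0 \<noteq> 0)"
  have "P (fps_shift (subdegree f) f)"
    using assms strip by (simp add: P_def)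
  then obtain p where p: "P p" and min: "\<And>g. P g \<Longrightarrow> subdegree (p $ 0) \<le> subdegree (g $ 0)"
    by (metis ex_has_least_nat[of P _ "\<lambda>g. subdegree (g $ 0)"])
  have "\<phi> g = 0 \<longleftrightarrow> p dvd g" for g
  proof
    assume "\<phi> g = 0"
    obtain q r where g: "g = q * p + r" and r: "\<And>i j. subdegree (p $ 0) \<le> j \<Longrightarrow> r $ i $ j = 0"
      using weierstrass_division[of p g] p unfolding P_def by metis
    have "\<phi> r = 0"
      using \<open>\<phi> g = 0\<close> p by (simp add: g add mult P_def)
    have "r = 0"
    proof (rule ccontr)
      assume "r \<noteq> 0"
      let ?r = "fps_shift (subdegree r) r"
      from \<open>r \<noteq> 0\<close> have nz: "?r $ 0 \<noteq> 0" by simp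
      with strip \<open>\<phi> r = 0\<close> have "P ?r" by (simp add: P_def)
      moreover from nz r have "subdegree (?r $ 0) < subdegree (p $ 0)"
        by (metis fps_shift_nth linorder_not_less nth_subdegree_nonzero)
      ultimately show False using min by fastforce
    qed
    with g show "p dvd g" by simp
  next
    assume "p dvd g"
    with p show "\<phi> g = 0" by (auto elim!: dvdE simp: mult P_def)
  qed
  then show ?thesis by (rule that)
qed

end

section \<open>Intersection multiplicities\<close>

lemma card_diff_translate:
  fixes S :: "nat set"
  assumes S: "\<And>n. N \<le> n \<Longrightarrow> n \<in> S" and sub: "(+) s ` S \<subseteq> S"
  shows "card (S - (+) s ` S) = s"
proof -
  let ?T = "(+) s ` S"
  have up: "n \<in> ?T" if "N + s \<le> n" for n
    using that S[of "n - s"] by (auto intro!: image_eqI[of _ _ "n - s"])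
  have diff: "S - ?T = S \<inter> {..<N + s} - (?T \<inter> {..<N + s})"
    using up leI by blast
  then have "card (S - ?T) = card (S \<inter> {..<N + s}) - card (?T \<inter> {..<N + s})"
    using sub by (subst diff, subst card_Diff_subset) auto
  moreover have split: "S \<inter> {..<N + s} = (S \<inter> {..<N}) \<union> {N..<N + s}"
    using S by auto
  have "card (S \<inter> {..<N + s}) = card (S \<inter> {..<N}) + s"
    unfolding split by (subst card_Un_disjoint) auto
  moreover have "?T \<inter> {..<N + s} = (+) s ` (S \<inter> {..<N})"
    by auto
  then have "card (?T \<inter> {..<N + s}) = card (S \<inter> {..<N})"
    by (simp add: card_image)
  ultimately show ?thesis by simp
qed

lemma subspace_ideal: "germ.subspace {u * f + v * g |u v. True}"
proof (rule germ.subspaceI)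
  show "0 \<in> {u * f + v * g |u v. True}"
    by (auto intro!: exI[of _ 0])
next
  fix a b assume "a \<in> {u * f + v * g |u v. True}" "b \<in> {u * f + v * g |u v. True}"
  then obtain u v u' v' where "a = u * f + v * g" "b = u' * f + v' * g" by auto
  then have "a + b = (u + u') * f + (v + v') * g" by (simp add: algebra_simps)
  then show "a + b \<in> {u * f + v * g |u v. True}" by blast
next
  fix c a assume "a \<in> {u * f + v * g |u v. True}"
  then obtain u v where "a = u * f + v * g" by auto
  then have "germ_scale c a = germ_scale c u * f + germ_scale c v * g"
    by (simp add: germ_scale_def algebra_simps)
  then show "germ_scale c a \<in> {u * f + v * g |u v. True}" by blast
qed

context parametrisation
begin

lemma orders_cofinite: obtains N where "\<And>n. N \<le> n \<Longrightarrow> n \<in> orders \<phi> UNIV"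
proof -
  obtain N where N: "\<And>u. fps_X ^ N * u \<in> range \<phi>"
    using conductor by blast
  have "n \<in> orders \<phi> UNIV" if "N \<le> n" for n
  proof -
    obtain g where "\<phi> g = fps_X ^ N * fps_X ^ (n - N)"
      using N by (metis rangeE)
    then have "\<phi> g = fps_X ^ n" using that by (simp flip: power_add)
    then show ?thesis
      by (force simp: orders_def intro!: exI[of _ g])
  qed
  then show ?thesis by (rule that)
qed

text \<open>
  The ideal \<open>(f, g)\<close> is the preimage of the principal ideal generated by \<open>\<phi> g\<close> in the image of \<open>\<phi>\<close>,
  so its orders are those of the image shifted by \<open>s = ord (\<phi> g)\<close>.  A cofinite set of orders loses
  exactly \<open>s\<close> elements under this shift.
\<close>

lemma intersection_mult_eq:
  assumes ker: "\<And>h. \<phi> h = 0 \<longleftrightarrow> f dvd h" and g: "\<phi> g \<noteq> 0"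
  shows "intersection_mult f g = subdegree (\<phi> g)"
proof -
  define I s where "I = {u * f + v * g |u v. True}" and "s = subdegree (\<phi> g)"
  have sub: "germ.subspace I"
    unfolding I_def by (rule subspace_ideal)
  have I: "h \<in> I \<longleftrightarrow> (\<exists>v. \<phi> h = \<phi> v * \<phi> g)" for h
  proof
    assume "h \<in> I"
    then show "\<exists>v. \<phi> h = \<phi> v * \<phi> g"
      using ker[of f] by (auto simp: I_def add mult)
  next
    assume "\<exists>v. \<phi> h = \<phi> v * \<phi> g"
    then obtain v where "\<phi> (h - v * g) = 0" by (auto simp: diff mult)
    then obtain u where "h - v * g = f * u" by (auto simp: ker elim: dvdE)
    then have "h = u * f + v * g" by (simp add: algebra_simps)
    then show "h \<in> I" by (auto simp: I_def)
  qed
  obtain N where N: "\<And>u. fps_X ^ N * u \<in> range \<phi>"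
    using conductor by blast
  have "germ.has_quotient_dim UNIV I (card (orders \<phi> UNIV - orders \<phi> I))"
  proof (rule has_quotient_dim_orders[where M = "N + s"])
    fix h assume "\<forall>i<N + s. \<phi> h $ i = 0"
    then have "fps_X ^ (N + s) dvd \<phi> h"
      by (cases "\<phi> h = 0") (auto simp: fps_dvd_iff nth_eq_0_below_iff)
    moreover have "fps_X ^ s = \<phi> g * inverse (fps_shift s (\<phi> g))"
      unfolding s_def by (rule fps_X_power_subdegree[OF g])
    moreover obtain u where "\<phi> h = fps_X ^ (N + s) * u"
      using calculation(1) by (rule dvdE)
    ultimately have u: "\<phi> h = fps_X ^ N * (inverse (fps_shift s (\<phi> g)) * u) * \<phi> g"
      by (simp add: power_add algebra_simps)
    obtain v where "\<phi> v = fps_X ^ N * (inverse (fps_shift s (\<phi> g)) * u)"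
      using N by (metis rangeE)
    with u show "h \<in> I" unfolding I by metis
  qed (simp_all add: sub add scale)
  moreover have "orders \<phi> I = (+) s ` orders \<phi> UNIV"
  proof (intro equalityI subsetI)
    fix n assume "n \<in> orders \<phi> I"
    then obtain h v where "\<phi> h \<noteq> 0" "\<phi> h = \<phi> v * \<phi> g" "n = subdegree (\<phi> h)"
      by (auto simp: orders_def I)
    then show "n \<in> (+) s ` orders \<phi> UNIV"
      by (auto simp: orders_def s_def intro!: image_eqI[of _ _ "subdegree (\<phi> v)"])
  next
    fix n assume "n \<in> (+) s ` orders \<phi> UNIV"
    then obtain v where "\<phi> v \<noteq> 0" "n = s + subdegree (\<phi> v)"
      by (auto simp: orders_def)
    then show "n \<in> orders \<phi> I"
      using g unfolding orders_def s_def
      by (intro CollectI exI[of _ "v * g"]) (auto simp: I mult)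
  qed
  moreover have "orders \<phi> I \<subseteq> orders \<phi> UNIV"
    by (auto simp: orders_def)
  ultimately have dim: "germ.has_quotient_dim UNIV I s"
    using card_diff_translate orders_cofinite by metis
  show ?thesis
    unfolding intersection_mult_def quotient_basis_iff I_def[symmetric] s_def[symmetric]
      germ.has_quotient_dim_def[symmetric]
    using dim germ.has_quotient_dim_unique[OF _ _ sub] by blast
qed

lemma semigroup_of_eq:
  assumes "\<And>h. \<phi> h = 0 \<longleftrightarrow> f dvd h"
  shows "semigroup_of f = orders \<phi> UNIV"
  using intersection_mult_eq[OF assms] assms by (force simp: semigroup_of_def orders_def)

end

section \<open>Blowing up\<close>

text \<open>
  The total transform \<open>g \<mapsto> g (x, x (y + c))\<close> is a homomorphism, and its coefficient of \<open>x\<^sup>k\<close> is the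
  homogeneous part of degree \<open>k\<close> of \<open>g\<close> evaluated at \<open>(1, y + c)\<close>.  So the multiplicity of \<open>g\<close> is the
  exponent of \<open>x\<close> in its total transform.
\<close>

lemma total_transform_nth:
  "total_transform c f $ k = (\<Sum>j\<le>k. fps_const (f $ (k - j) $ j) * (fps_X + fps_const c) ^ j)"
  by (simp add: total_transform_def)

lemma total_transform_add: "total_transform c (f + g) = total_transform c f + total_transform c g"
  by (rule fps_ext)
    (simp add: total_transform_nth sum.distrib distrib_right fps_const_add[symmetric] del: fps_const_add)

lemma total_transform_mult: "total_transform c (f * g) = total_transform c f * total_transform c g"
proof (rule fps_ext)
  fix k
  define z :: "complex fps" where "z = fps_X + fps_const c"
  let ?T = "\<lambda>a b a' b'. fps_const (f $ a $ b) * fps_const (g $ a' $ b') * (z ^ b * z ^ b')"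
  have "total_transform c (f * g) $ k = (\<Sum>j\<le>k. fps_const ((f * g) $ (k - j) $ j) * z ^ j)"
    by (simp add: total_transform_nth z_def)
  also have "\<dots> = (\<Sum>j\<le>k. \<Sum>i\<le>k - j. \<Sum>l\<le>j. ?T i l (k - j - i) (j - l))"
    by (intro sum.cong refl)
      (simp add: fps_mult_nth fps_sum_nth atLeast0AtMost fps_const_sum sum_distrib_right
        fps_const_mult[symmetric] power_add[symmetric] del: fps_const_mult)
  also have "\<dots> = (\<Sum>(j, i, l) \<in> (SIGMA j:{..k}. SIGMA i:{..k - j}. {..j}).
      ?T i l (k - j - i) (j - l))"
    by (simp add: sum.Sigma)
  \<comment> \<open>The index \<open>(j, i, l)\<close> pairs \<open>x\<^sup>i y\<^sup>l\<close> in \<open>f\<close> with \<open>y\<^bsup>j-l\<^esup>\<close> in \<open>g\<close>; now sort by the degree \<open>m = i + l\<close>.\<close>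
  also have "\<dots> = (\<Sum>(m, l, n) \<in> (SIGMA m:{..k}. SIGMA l:{..m}. {..k - m}).
      ?T (m - l) l (k - m - n) n)"
    by (rule sum.reindex_bij_witness[where i = "\<lambda>(m, l, n). (l + n, m - l, l)"
          and j = "\<lambda>(j, i, l). (i + l, l, j - l)"]) (auto simp: add.commute)
  also have "\<dots> = (\<Sum>m\<le>k. \<Sum>l\<le>m. \<Sum>n\<le>k - m. ?T (m - l) l (k - m - n) n)"
    by (simp add: sum.Sigma)
  also have "\<dots> = (\<Sum>m\<le>k. total_transform c f $ m * total_transform c g $ (k - m))"
    by (simp add: total_transform_nth z_def sum_product mult_ac)
  finally show "total_transform c (f * g) $ k = (total_transform c f * total_transform c g) $ k"
    by (simp add: fps_mult_nth atLeast0AtMost)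
qed

lemma total_transform_from_x: "total_transform c (from_x u) = from_x u"
proof (rule fps_ext)
  fix k
  have "total_transform c (from_x u) $ k = (\<Sum>j\<le>k. if j = 0 then fps_const (u $ k) else 0)"
    unfolding total_transform_nth by (intro sum.cong) auto
  then show "total_transform c (from_x u) $ k = from_x u $ k"
    by simp
qed

lemma from_x_fps_X: "from_x fps_X = (fps_X :: 'a::comm_ring_1 fps fps)"
  by (rule fps_ext) (simp add: fps_X_def)

lemma total_transform_const: "total_transform c (fps_const (fps_const a)) = fps_const (fps_const a)"
  using total_transform_from_x[of c "fps_const a"] by (simp add: from_x_const)

lemma total_transform_X: "total_transform c fps_X = fps_X"
  using total_transform_from_x[of c fps_X] by (simp add: from_x_fps_X)

lemma total_transform_power: "total_transform c (g ^ n) = total_transform c g ^ n"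
  by (induction n)
    (use total_transform_const[of c 1] in \<open>simp_all add: total_transform_mult\<close>)

lemma total_transform_zero: "total_transform c 0 = 0"
  using total_transform_const[of c 0] by simp

lemma total_transform_sum: "total_transform c (\<Sum>i\<in>A. h i) = (\<Sum>i\<in>A. total_transform c (h i))"
  by (induction A rule: infinite_finite_induct) (simp_all add: total_transform_add total_transform_zero)

lemma total_transform_Y:
  "total_transform c (fps_const fps_X) = fps_X * fps_const (fps_X + fps_const c)"
proof (rule fps_ext)
  fix k
  have "total_transform c (fps_const fps_X) $ k =
      (\<Sum>j\<le>k. if j = 1 then (if k = 1 then fps_X + fps_const c else 0) else 0)"
    unfolding total_transform_nth by (intro sum.cong) (auto simp: fps_X_def)
  then show "total_transform c (fps_const fps_X) $ k = (fps_X * fps_const (fps_X + fps_const c)) $ k"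
    by auto
qed

text \<open>The line through the origin in the direction of the centre of the next blow-up.\<close>

definition line :: "complex \<Rightarrow> germ" where
  "line c = fps_const fps_X - fps_const (fps_const c) * fps_X"

lemma total_transform_line: "total_transform c (line c) = fps_X * fps_const fps_X"
proof -
  have "total_transform c (line c) + total_transform c (fps_const (fps_const c) * fps_X) =
      total_transform c (fps_const fps_X)"
    by (simp add: line_def flip: total_transform_add)
  then show ?thesis
    by (simp add: total_transform_mult total_transform_const total_transform_X total_transform_Y
        algebra_simps fps_const_add[symmetric] del: fps_const_add)
qed

lemma shifted_power_nth:
  "((fps_X + fps_const c :: 'a::comm_ring_1 fps) ^ j) $ i = (if i = j then 1 else 0)" if "j \<le> i"
  using that
proof (induction j arbitrary: i)
  case (Suc j)
  then obtain i' where i: "i = Suc i'" by (cases i) auto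
  have "((fps_X + fps_const c) ^ Suc j) $ i =
      ((fps_X + fps_const c) ^ j) $ i' + c * ((fps_X + fps_const c) ^ j) $ i"
    by (simp add: distrib_right i)
  with Suc i show ?case by simp
qed auto

text \<open>A nonzero polynomial of degree at most \<open>m\<close>, written in powers of \<open>y + c\<close>, has order at most \<open>m\<close>.\<close>

lemma shifted_polynomial_nonzero:
  fixes a :: "nat \<Rightarrow> 'a::comm_ring_1" and c :: 'a
  assumes "j \<le> m" "a j \<noteq> 0"
  defines "P \<equiv> (\<Sum>j\<le>m. fps_const (a j) * (fps_X + fps_const c) ^ j)"
  shows "P \<noteq> 0" "subdegree P \<le> m"
proof -
  define J where "J = Max {j. j \<le> m \<and> a j \<noteq> 0}"
  have "J \<in> {j. j \<le> m \<and> a j \<noteq> 0}"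
    unfolding J_def using assms by (intro Max_in) auto
  moreover have "a j = 0" if "J < j" "j \<le> m" for j
    using that Max_ge[of "{j. j \<le> m \<and> a j \<noteq> 0}" j] by (auto simp: J_def[symmetric])
  ultimately have J: "J \<le> m" "a J \<noteq> 0" "\<And>j. J < j \<Longrightarrow> j \<le> m \<Longrightarrow> a j = 0"
    by auto
  have "P $ J = (\<Sum>j\<le>m. if j = J then a J else 0)"
    unfolding P_def fps_sum_nth
  proof (rule sum.cong)
    fix j assume "j \<in> {..m}"
    then show "(fps_const (a j) * (fps_X + fps_const c) ^ j) $ J = (if j = J then a J else 0)"
      using J(3)[of j] by (cases "j \<le> J") (auto simp: shifted_power_nth)
  qed simp
  with J have "P $ J \<noteq> 0" by simp
  with J show "P \<noteq> 0" "subdegree P \<le> m"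
    by (auto intro: subdegree_leI order.trans)
qed

lemma total_transform_nth_eq_0_iff:
  "total_transform c f $ k = 0 \<longleftrightarrow> (\<forall>i j. i + j = k \<longrightarrow> f $ i $ j = 0)"
proof
  assume 0: "total_transform c f $ k = 0"
  show "\<forall>i j. i + j = k \<longrightarrow> f $ i $ j = 0"
  proof (intro allI impI, rule ccontr)
    fix i j assume "i + j = k" "f $ i $ j \<noteq> 0"
    then show False
      using shifted_polynomial_nonzero(1)[of j k "\<lambda>j. f $ (k - j) $ j" c] 0
      by (auto simp: total_transform_nth)
  qed
qed (auto simp: total_transform_nth intro!: sum.neutral)

definition order_ideal :: "nat \<Rightarrow> germ set" where
  "order_ideal m = {g. \<forall>i j. i + j < m \<longrightarrow> g $ i $ j = 0}"

lemma order_ideal_iff: "g \<in> order_ideal m \<longleftrightarrow> (\<forall>k<m. total_transform c g $ k = 0)"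
  by (auto simp: order_ideal_def total_transform_nth_eq_0_iff)

lemma fps_eq_X_power_mult_shift:
  fixes h :: "'a::comm_ring_1 fps"
  assumes "\<forall>k<m. h $ k = 0"
  shows "h = fps_X ^ m * fps_shift m h"
  by (rule fps_ext) (use assms in \<open>auto simp: fps_X_power_mult_nth\<close>)

lemma germ_mult_props:
  assumes "f \<noteq> 0"
  shows "f \<in> order_ideal (germ_mult f)"
    and "\<exists>i j. i + j = germ_mult f \<and> f $ i $ j \<noteq> 0"
proof -
  have "\<exists>n i j. i + j = n \<and> f $ i $ j \<noteq> 0"
    using assms by (auto simp: fps_eq_iff)
  from LeastI_ex[OF this] show "\<exists>i j. i + j = germ_mult f \<and> f $ i $ j \<noteq> 0"
    by (simp add: germ_mult_def)
  show "f \<in> order_ideal (germ_mult f)"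
    unfolding order_ideal_def germ_mult_def
    using not_less_Least[of _ "\<lambda>n. \<exists>i j. i + j = n \<and> f $ i $ j \<noteq> 0"] by blast
qed

lemma total_transform_germ_mult:
  fixes c :: complex
  assumes "f \<noteq> 0"
  defines "g \<equiv> fps_shift (germ_mult f) (total_transform c f)"
  shows "total_transform c f = fps_X ^ germ_mult f * g"
    and "g $ 0 \<noteq> 0" and "subdegree (g $ 0) \<le> germ_mult f"
proof -
  let ?m = "germ_mult f"
  show "total_transform c f = fps_X ^ ?m * g"
    unfolding g_def using germ_mult_props(1)[OF assms(1)]
    by (intro fps_eq_X_power_mult_shift) (simp add: order_ideal_iff[of _ _ c])
  obtain i j where "i + j = ?m" "f $ i $ j \<noteq> 0"
    using germ_mult_props(2)[OF assms(1)] by blast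
  then have "j \<le> ?m" "f $ (?m - j) $ j \<noteq> 0" by (auto simp flip: \<open>i + j = ?m\<close>)
  from shifted_polynomial_nonzero[where a = "\<lambda>j. f $ (?m - j) $ j" and c = c, OF this]
  show "g $ 0 \<noteq> 0" "subdegree (g $ 0) \<le> ?m"
    by (simp_all add: g_def total_transform_nth)
qed

text \<open>
  \<open>x\<^sup>m y\<^sup>j\<close> is the total transform of \<open>x\<^bsup>m-j\<^esup> (y - c x)\<^sup>j\<close> for \<open>j \<le> m\<close>.  Together with Weierstrass
  division this shows that every series on the blown-up plane is, up to a multiple of a given series
  of order at most \<open>m\<close> in \<open>y\<close>, a total transform divided by \<open>x\<^sup>m\<close>.
\<close>

lemma lift_small_y_degree:
  fixes r :: germ
  assumes r: "\<And>i j. d \<le> j \<Longrightarrow> r $ i $ j = 0" and "d \<le> m"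
  obtains g where "total_transform c g = fps_X ^ m * r"
proof
  let ?r = "\<lambda>j. from_x (Abs_fps (\<lambda>i. r $ i $ j))"
  let ?g = "\<Sum>j<d. ?r j * fps_X ^ (m - j) * line c ^ j"
  have "total_transform c ?g = (\<Sum>j<d. ?r j * fps_X ^ (m - j) * (fps_X * fps_const fps_X) ^ j)"
    by (simp add: total_transform_sum total_transform_mult total_transform_power
        total_transform_from_x total_transform_X total_transform_line)
  also have "\<dots> = (\<Sum>j<d. fps_X ^ m * (?r j * fps_const fps_X ^ j))"
  proof (rule sum.cong)
    fix j assume "j \<in> {..<d}"
    with \<open>d \<le> m\<close> have "(fps_X :: germ) ^ m = fps_X ^ (m - j) * fps_X ^ j"
      by (simp flip: power_add)
    then show "?r j * fps_X ^ (m - j) * (fps_X * fps_const fps_X) ^ j =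
        fps_X ^ m * (?r j * fps_const fps_X ^ j)"
      by (simp only: power_mult_distrib mult_ac)
  qed simp
  also have "\<dots> = fps_X ^ m * r"
    by (subst (2) expand_in_y[OF r]) (simp_all add: sum_distrib_left)
  finally show "total_transform c ?g = fps_X ^ m * r" .
qed

lemma monomial_nth:
  "(fps_X ^ a * fps_const fps_X ^ b :: 'a::comm_ring_1 fps fps) $ i $ j = (if i = a \<and> j = b then 1 else 0)"
  by (auto simp: fps_X_power_mult_nth fps_X_power_iff)

lemma subspace_order_ideal: "germ.subspace (order_ideal m)"
  by (rule germ.subspaceI) (auto simp: order_ideal_def germ_scale_def)

lemma has_quotient_dim_order_ideal_Suc:
  "germ.has_quotient_dim (order_ideal m) (order_ideal (Suc m)) (Suc m)"
proof -
  let ?b = "\<lambda>j. fps_X ^ (m - j) * fps_const fps_X ^ j :: germ"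
  have coeff: "(\<Sum>j\<le>m. germ_scale (a j) (?b j)) $ i $ l = (if i + l = m then a l else 0)" for a i l
  proof -
    have "(\<Sum>j\<le>m. germ_scale (a j) (?b j)) $ i $ l = (\<Sum>j\<le>m. a j * ?b j $ i $ l)"
      by (simp add: fps_sum_nth germ_scale_def)
    also have "\<dots> = (\<Sum>j\<le>m. if j = l then (if i + l = m then a l else 0) else 0)"
      by (intro sum.cong) (auto simp: monomial_nth)
    finally show ?thesis by auto
  qed
  have "germ.basis_modulo (order_ideal m) (order_ideal (Suc m)) {..m} ?b"
    unfolding germ.basis_modulo_def
  proof (intro conjI ballI allI impI)
    fix j assume "j \<in> {..m}"
    then show "?b j \<in> order_ideal m"
      by (auto simp: order_ideal_def monomial_nth)
  next
    fix w assume "w \<in> order_ideal m"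
    then show "\<exists>a. w - (\<Sum>j\<le>m. germ_scale (a j) (?b j)) \<in> order_ideal (Suc m)"
      by (intro exI[of _ "\<lambda>j. w $ (m - j) $ j"]) (auto simp: order_ideal_def coeff less_Suc_eq simp del: fps_const_power)
  next
    fix a j assume a: "(\<Sum>j\<le>m. germ_scale (a j) (?b j)) \<in> order_ideal (Suc m)" and "j \<in> {..m}"
    then have "(\<Sum>j\<le>m. germ_scale (a j) (?b j)) $ (m - j) $ j = 0"
      by (simp add: order_ideal_def del: fps_const_power)
    with \<open>j \<in> {..m}\<close> show "a j = 0" by (simp add: coeff del: fps_const_power)
  qed
  from germ.has_quotient_dimI[OF this] show ?thesis by simp
qed

lemma order_ideal_mono: "m \<le> n \<Longrightarrow> order_ideal n \<subseteq> order_ideal m"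
  by (auto simp: order_ideal_def)

lemma has_quotient_dim_order_ideal: "germ.has_quotient_dim UNIV (order_ideal m) (\<Sum>{..m})"
proof (induction m)
  case 0
  have "germ.basis_modulo UNIV (order_ideal 0) {} undefined"
    by (simp add: germ.basis_modulo_def order_ideal_def)
  from germ.has_quotient_dimI[OF this] show ?case by simp
next
  case (Suc m)
  from germ.has_quotient_dim_add[OF Suc has_quotient_dim_order_ideal_Suc subspace_order_ideal]
  show ?case by (simp add: order_ideal_mono)
qed

definition order_count :: "(germ \<Rightarrow> complex fps) \<Rightarrow> int \<Rightarrow> int" where
  "order_count \<phi> k = int (card {s \<in> orders \<phi> UNIV. int s < k})"

lemma parametrisation_nth_0: "parametrisation (\<lambda>g. g $ 0)"
proof
  show "\<exists>N. \<forall>u. fps_X ^ N * u \<in> range (\<lambda>g :: germ. g $ 0)"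
    by (intro exI[of _ 0] allI) (auto intro!: image_eqI[of _ _ "fps_const _"])
qed auto

lemma fps_X_dvd_iff_nth_0: "fps_X dvd h \<longleftrightarrow> (h :: 'a::comm_ring_1 fps) $ 0 = 0"
proof
  assume "h $ 0 = 0"
  then have "h = fps_X ^ 1 * fps_shift 1 h"
    by (intro fps_eq_X_power_mult_shift) auto
  then show "fps_X dvd h" by (metis dvd_triv_left power_one_right)
qed (auto elim: dvdE)

lemma mult_unit_dvd:
  fixes p :: "'a::comm_semiring_1"
  assumes "q dvd 1"
  shows "p * q dvd g \<longleftrightarrow> p dvd g"
proof -
  obtain q' where "1 = q * q'" using assms by (rule dvdE)
  then have "p = p * q * q'" by (simp add: mult.assoc)
  then show ?thesis by (metis dvd_trans dvd_triv_left)
qed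

lemma intersection_mult_commute: "intersection_mult f g = intersection_mult g f"
proof -
  have "{u * f + v * g |u v. True} = {u * g + v * f |u v. True}"
    by (auto; metis add.commute)
  then show ?thesis by (simp add: intersection_mult_def)
qed

context parametrisation
begin

text \<open>
  Both sides are the intersection multiplicity of \<open>p\<close> with the line \<open>x = 0\<close>, whose parametrisation
  is the restriction \<open>g \<mapsto> g $ 0\<close>.
\<close>

lemma y_order_generator:
  assumes ker: "\<And>h. \<phi> h = 0 \<longleftrightarrow> p dvd h" and "p \<noteq> 0" and X: "\<phi> fps_X \<noteq> 0"
  shows "p $ 0 \<noteq> 0" and "subdegree (p $ 0) = subdegree (\<phi> fps_X)"
proof -
  interpret line: parametrisation "\<lambda>g. g $ 0"
    by (rule parametrisation_nth_0)
  show nz: "p $ 0 \<noteq> 0"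
  proof
    assume "p $ 0 = 0"
    then obtain p' where p': "p = fps_X * p'"
      by (auto simp flip: fps_X_dvd_iff_nth_0 elim: dvdE)
    with X ker[of p] have "\<phi> p' = 0" by (simp add: mult)
    then obtain q where "p' = p * q" by (auto simp: ker elim: dvdE)
    with p' have "p = p * (fps_X * q)" by (simp add: mult_ac)
    with \<open>p \<noteq> 0\<close> have "fps_X * q = 1" by simp
    then have "(fps_X * q) $ 0 = 1" by simp
    then show False by simp
  qed
  have "subdegree (\<phi> fps_X) = intersection_mult p fps_X"
    using intersection_mult_eq[OF ker X] by simp
  also have "\<dots> = intersection_mult fps_X p"
    by (rule intersection_mult_commute)
  also have "\<dots> = subdegree (p $ 0)"
    using nz by (intro line.intersection_mult_eq) (auto simp: fps_X_dvd_iff_nth_0)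
  finally show "subdegree (p $ 0) = subdegree (\<phi> fps_X)" ..
qed

lemma subspace_orders_ge: "germ.subspace W \<Longrightarrow> germ.subspace (W \<inter> {g. \<forall>i. int i < k \<longrightarrow> \<phi> g $ i = 0})"
  by (rule germ.subspaceI)
    (auto simp: add scale germ.subspace_0 germ.subspace_add germ.subspace_scale)

text \<open>With \<open>W\<close> the whole ring, the counting function is the codimension of the valuation ideals.\<close>

lemma has_quotient_dim_count:
  assumes "germ.subspace W"
  shows "germ.has_quotient_dim W (W \<inter> {g. \<forall>i. int i < k \<longrightarrow> \<phi> g $ i = 0})
    (card {s \<in> orders \<phi> W. int s < k})"
proof -
  let ?V = "W \<inter> {g. \<forall>i. int i < k \<longrightarrow> \<phi> g $ i = 0}"
  have "(\<forall>i. int i < k \<longrightarrow> \<phi> g $ i = 0) \<longleftrightarrow> k \<le> int (subdegree (\<phi> g))" if "\<phi> g \<noteq> 0" for g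
    using that by (meson le_less_linear nth_less_subdegree_zero nth_subdegree_nonzero of_nat_less_iff order_less_le_trans)
  then have "orders \<phi> W - orders \<phi> ?V = {s \<in> orders \<phi> W. int s < k}"
    by (fastforce simp: orders_def not_less)
  moreover have "germ.has_quotient_dim W ?V (card (orders \<phi> W - orders \<phi> ?V))"
    by (rule has_quotient_dim_orders[where M = "nat k"])
      (auto simp: assms subspace_orders_ge add scale)
  ultimately show ?thesis by simp
qed

end

section \<open>One blow-up\<close>

text \<open>
  A parametrised germ \<open>f'\<close> that is the strict transform of \<open>f\<close>; the composition of \<open>\<phi>'\<close> with the
  blow-up then parametrises \<open>f\<close>.
\<close>

locale blow_up_chart = parametrisation \<phi>' for \<phi>' +
  fixes c :: complex and f f' :: germ
  assumes f_nonzero: "f \<noteq> 0"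
    and total_transform: "total_transform c f = fps_X ^ germ_mult f * f'"
    and vanishes: "\<phi>' f' = 0"
begin

definition \<phi> :: "germ \<Rightarrow> complex fps" where
  "\<phi> g = \<phi>' (total_transform c g)"

lemma transform_y_regular: "f' $ 0 \<noteq> 0" "subdegree (f' $ 0) \<le> germ_mult f"
proof -
  have "f' = fps_shift (germ_mult f) (total_transform c f)"
    by (rule fps_ext) (simp add: total_transform fps_X_power_mult_nth)
  then show "f' $ 0 \<noteq> 0" "subdegree (f' $ 0) \<le> germ_mult f"
    using total_transform_germ_mult[OF f_nonzero, of c] by simp_all
qed

text \<open>The strict transform does not contain the exceptional divisor.\<close>

lemma X_nonzero: "\<phi>' fps_X \<noteq> 0"
proof
  assume "\<phi>' fps_X = 0"
  then have "fps_X dvd f'"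
    using vanishes kernel_fps_X by blast
  with transform_y_regular show False by (simp add: fps_X_dvd_iff_nth_0)
qed

lemma composite_X: "\<phi> fps_X = \<phi>' fps_X"
  by (simp add: \<phi>_def total_transform_X)

lemma composite_vanishes: "\<phi> f = 0"
  by (simp add: \<phi>_def total_transform mult vanishes)



lemma divide_and_lift:
  assumes p: "p $ 0 \<noteq> 0" "subdegree (p $ 0) \<le> m"
  obtains g q where "total_transform c g = fps_X ^ m * (h - q * p)"
proof -
  obtain q r where h: "h = q * p + r" and r: "\<And>i j. subdegree (p $ 0) \<le> j \<Longrightarrow> r $ i $ j = 0"
    using weierstrass_division[OF p(1)] by blast
  obtain g where "total_transform c g = fps_X ^ m * r"
    using lift_small_y_degree[OF r p(2)] by blast
  then have "total_transform c g = fps_X ^ m * (h - q * p)"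
    by (simp add: h)
  then show ?thesis by (rule that)
qed

text \<open>
  The conductor passes to the composition: dividing by \<open>f'\<close>, on which \<open>\<phi>'\<close> vanishes, and lifting the
  remainder shows that the image of \<open>\<phi>\<close> contains a fixed power of \<open>\<phi>' x\<close> times the image of \<open>\<phi>'\<close>.
\<close>

sublocale composite: parametrisation \<phi>
proof
  fix g h show "\<phi> (g + h) = \<phi> g + \<phi> h"
    by (simp add: \<phi>_def total_transform_add add)
next
  fix g h show "\<phi> (g * h) = \<phi> g * \<phi> h"
    by (simp add: \<phi>_def total_transform_mult mult)
next
  fix a show "\<phi> (fps_const (fps_const a)) = fps_const a"
    by (simp add: \<phi>_def total_transform_const const)
next
  obtain N where N: "\<And>u. fps_X ^ N * u \<in> range \<phi>'"
    using conductor by blast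
  define s e where "s = subdegree (\<phi>' fps_X)" and "e = germ_mult f"
  define w where "w = fps_shift s (\<phi>' fps_X)"
  have w: "fps_X ^ s = \<phi>' fps_X * inverse w"
    unfolding s_def w_def by (rule fps_X_power_subdegree[OF X_nonzero])
  have "fps_X ^ (s * e + N) * u \<in> range \<phi>" for u
  proof -
    obtain h where h: "\<phi>' h = fps_X ^ N * (inverse w ^ e * u)"
      using N by (metis rangeE)
    obtain g q where g: "total_transform c g = fps_X ^ e * (h - q * f')"
      using divide_and_lift[OF transform_y_regular] unfolding e_def by blast
    then have "\<phi> g = \<phi>' fps_X ^ e * \<phi>' h"
      by (simp add: \<phi>_def mult diff power vanishes)
    also have "\<dots> = fps_X ^ N * (\<phi>' fps_X * inverse w) ^ e * u"
      by (simp only: h power_mult_distrib mult_ac)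
    also have "\<dots> = fps_X ^ (s * e + N) * u"
      unfolding w[symmetric] power_add power_mult by (simp only: mult_ac)
    finally show ?thesis by (metis rangeI)
  qed
  then show "\<exists>N. \<forall>u. fps_X ^ N * u \<in> range \<phi>" by blast
qed

context
  assumes ker: "\<And>g. \<phi> g = 0 \<longleftrightarrow> f dvd g"
begin

text \<open>
  Let \<open>p\<close> generate the kernel of \<open>\<phi>'\<close> and let \<open>N\<close> be the order of \<open>\<phi> x = \<phi>' x\<close>.  Intersection with
  the line \<open>x = 0\<close> shows that \<open>f\<close> and \<open>p\<close> both have order \<open>N\<close> in \<open>y\<close>.  Hence the multiplicity of \<open>f\<close> is at
  most \<open>N\<close>.  It bounds the order in \<open>y\<close> of the multiple \<open>f'\<close> of \<open>p\<close>, which is at least \<open>N\<close>.  So all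
  these numbers agree, and the cofactor \<open>f' / p\<close> is a unit.
\<close>

lemma germ_mult_eq: "germ_mult f = subdegree (\<phi>' fps_X)"
  and kernel_transform: "\<phi>' g = 0 \<longleftrightarrow> f' dvd g"
proof -
  let ?N = "subdegree (\<phi>' fps_X)"
  have "f' \<noteq> 0" using transform_y_regular by auto
  then obtain p where p: "\<And>g. \<phi>' g = 0 \<longleftrightarrow> p dvd g"
    using kernel_principal[OF _ vanishes] by blast
  then obtain q where q: "f' = p * q"
    using vanishes by (auto elim: dvdE)
  with \<open>f' \<noteq> 0\<close> have "p \<noteq> 0" by auto
  note p_order = y_order_generator[OF p this X_nonzero]
  have "f $ 0 \<noteq> 0" "subdegree (f $ 0) = ?N"
    using composite.y_order_generator[OF ker f_nonzero] X_nonzero by (simp_all add: composite_X)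
  then have "f $ 0 $ ?N \<noteq> 0"
    by (metis nth_subdegree_nonzero)
  then have "germ_mult f \<le> ?N"
    using germ_mult_props(1)[OF f_nonzero]
    unfolding order_ideal_def by (metis (mono_tags, lifting) add_0 linorder_not_less mem_Collect_eq)
  moreover have "q $ 0 \<noteq> 0" using transform_y_regular by (auto simp: q)
  then have "subdegree (f' $ 0) = ?N + subdegree (q $ 0)"
    using p_order by (simp add: q)
  ultimately have "germ_mult f = ?N" and "subdegree (q $ 0) = 0"
    using transform_y_regular(2) by auto
  then show "germ_mult f = subdegree (\<phi>' fps_X)" by simp
  have "q $ 0 $ 0 \<noteq> 0"
    using \<open>q $ 0 \<noteq> 0\<close> \<open>subdegree (q $ 0) = 0\<close> by (metis nth_subdegree_nonzero)
  then have "q dvd 1" by (simp add: germ_unit_iff)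
  then have "f' dvd g \<longleftrightarrow> p dvd g"
    unfolding q by (rule mult_unit_dvd)
  then show "\<phi>' g = 0 \<longleftrightarrow> f' dvd g" by (simp add: p)
qed

text \<open>Noether's formula: if \<open>g\<close> has the total transform \<open>x\<^sup>m h\<close> then \<open>I(f, g) = n m + I(f', h)\<close>.\<close>

lemma orders_order_ideal:
  assumes "s \<in> orders \<phi> (order_ideal m)"
  obtains s' where "s' \<in> orders \<phi>' UNIV" "s = germ_mult f * m + s'"
proof -
  obtain g where g: "g \<in> order_ideal m" "\<phi> g \<noteq> 0" "s = subdegree (\<phi> g)"
    using assms by (auto simp: orders_def)
  define h where "h = fps_shift m (total_transform c g)"
  have "total_transform c g = fps_X ^ m * h"
    unfolding h_def using g(1) by (intro fps_eq_X_power_mult_shift) (simp add: order_ideal_iff[of _ _ c])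
  then have "\<phi> g = \<phi>' fps_X ^ m * \<phi>' h"
    by (simp add: \<phi>_def mult power)
  with g have "\<phi>' h \<noteq> 0" "s = germ_mult f * m + subdegree (\<phi>' h)"
    by (auto simp: germ_mult_eq)
  then show ?thesis by (intro that[of "subdegree (\<phi>' h)"]) (auto simp: orders_def)
qed

abbreviation "vanishing_ideal k \<equiv> {g. \<forall>i. int i < k \<longrightarrow> \<phi> g $ i = 0}"

text \<open>
  Multiplicity at least \<open>m\<close> costs \<open>0 + 1 + \<dots> + m\<close> conditions, and by Noether's formula at most
  \<open>H' (k - n m)\<close> further ones make the intersection multiplicity reach \<open>k\<close>.
\<close>

lemma order_count_le:
  "order_count \<phi> k \<le> int (\<Sum>{..m}) + order_count \<phi>' (k - int (germ_mult f * m))"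
proof -
  let ?n = "germ_mult f"
  have "germ.has_quotient_dim UNIV (order_ideal m \<inter> vanishing_ideal k)
      (\<Sum>{..m} + card {s \<in> orders \<phi> (order_ideal m). int s < k})"
    by (intro germ.has_quotient_dim_add[OF has_quotient_dim_order_ideal]
        composite.has_quotient_dim_count subspace_order_ideal) auto
  from germ.has_quotient_dim_antimono[OF composite.has_quotient_dim_count[of UNIV k] this]
  have "card {s \<in> orders \<phi> UNIV. int s < k} \<le>
      \<Sum>{..m} + card {s \<in> orders \<phi> (order_ideal m). int s < k}"
    using composite.subspace_orders_ge[of UNIV k] by auto
  also have "card {s \<in> orders \<phi> (order_ideal m). int s < k} \<le>
      card ((+) (?n * m) ` {s \<in> orders \<phi>' UNIV. int s < k - int (?n * m)})"
  proof (rule card_mono)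
    have "finite {s. int s < k - int (?n * m)}"
      by (rule finite_subset[of _ "{..<nat (k - int (?n * m))}"]) auto
    then show "finite ((+) (?n * m) ` {s \<in> orders \<phi>' UNIV. int s < k - int (?n * m)})"
      by simp
    show "{s \<in> orders \<phi> (order_ideal m). int s < k} \<subseteq>
        (+) (?n * m) ` {s \<in> orders \<phi>' UNIV. int s < k - int (?n * m)}"
    proof
      fix s assume s: "s \<in> {s \<in> orders \<phi> (order_ideal m). int s < k}"
      then obtain s' where "s' \<in> orders \<phi>' UNIV" "s = ?n * m + s'"
        using orders_order_ideal by blast
      with s show "s \<in> (+) (?n * m) ` {s \<in> orders \<phi>' UNIV. int s < k - int (?n * m)}"
        by auto
    qed
  qed
  also have "\<dots> = card {s \<in> orders \<phi>' UNIV. int s < k - int (?n * m)}"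
    by (rule card_image) simp
  finally show ?thesis
    unfolding order_count_def by linarith
qed

text \<open>
  For the least multiplicity \<open>m\<close> of a germ \<open>g0\<close> in the valuation ideal, that ideal lies in the ideal
  of germs of multiplicity at least \<open>m\<close>, so the two numbers of conditions add up.  Division by the
  transform \<open>p\<close> of \<open>g0\<close> lifts every small order of \<open>\<phi>'\<close>: it changes \<open>\<phi>' h\<close> only by a multiple of
  \<open>\<phi>' p\<close>, which has order at least \<open>k - n m\<close>.
\<close>

lemma order_count_attained:
  "\<exists>m. int (\<Sum>{..m}) + order_count \<phi>' (k - int (germ_mult f * m)) \<le> order_count \<phi> k"
proof -
  let ?n = "germ_mult f"
  have "\<exists>g0. (g0 \<noteq> 0 \<and> g0 \<in> vanishing_ideal k) \<and> (\<forall>g. g \<noteq> 0 \<and> g \<in> vanishing_ideal k \<longrightarrow> germ_mult g0 \<le> germ_mult g)"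
    by (rule ex_has_least_nat[of _ f]) (simp add: f_nonzero composite_vanishes)
  then obtain g0 where g0: "g0 \<noteq> 0" "g0 \<in> vanishing_ideal k"
    and min: "\<And>g. g \<noteq> 0 \<Longrightarrow> g \<in> vanishing_ideal k \<Longrightarrow> germ_mult g0 \<le> germ_mult g"
    by blast
  define m where "m = germ_mult g0"
  have sub: "vanishing_ideal k \<subseteq> order_ideal m"
  proof
    fix g assume "g \<in> vanishing_ideal k"
    show "g \<in> order_ideal m"
    proof (cases "g = 0")
      case False
      with min \<open>g \<in> vanishing_ideal k\<close> have "m \<le> germ_mult g" by (simp add: m_def)
      then show ?thesis
        using germ_mult_props(1)[OF False] order_ideal_mono by blast
    qed (simp add: order_ideal_def)
  qed
  define p where "p = fps_shift m (total_transform c g0)"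
  have p: "total_transform c g0 = fps_X ^ m * p" "p $ 0 \<noteq> 0" "subdegree (p $ 0) \<le> m"
    using total_transform_germ_mult[OF g0(1), of c] by (simp_all add: p_def m_def)
  \<comment> \<open>The lifting of orders, by division with remainder by \<open>p\<close>.\<close>
  have order: "?n * m + s \<in> orders \<phi> (order_ideal m)"
    if s: "s \<in> orders \<phi>' UNIV" "int s < k - int (?n * m)" for s
  proof -
    obtain h where h: "\<phi>' h \<noteq> 0" "s = subdegree (\<phi>' h)"
      using s by (auto simp: orders_def)
    obtain g q where g: "total_transform c g = fps_X ^ m * (h - q * p)"
      using divide_and_lift[OF p(2,3)] by blast
    then have phi_g: "\<phi> g = \<phi>' fps_X ^ m * (\<phi>' h - \<phi>' q * \<phi>' p)"
      by (simp add: \<phi>_def mult power diff)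
    have "\<phi> g0 = \<phi>' fps_X ^ m * \<phi>' p"
      by (simp add: \<phi>_def p mult power)
    then have p_order: "\<phi>' p \<noteq> 0 \<longrightarrow> k \<le> int (?n * m + subdegree (\<phi>' p))"
      using g0(2) X_nonzero nth_subdegree_nonzero[of "\<phi> g0"]
      by (auto simp: germ_mult_eq mult.commute simp flip: not_less)
    have small: "(\<phi>' q * \<phi>' p) $ i = 0" if "i \<le> s" for i
    proof (cases "\<phi>' q = 0 \<or> \<phi>' p = 0")
      case False
      with p_order s(2) that show ?thesis
        by (intro nth_less_subdegree_zero) simp
    qed auto
    have "\<phi>' h - \<phi>' q * \<phi>' p \<noteq> 0 \<and> subdegree (\<phi>' h - \<phi>' q * \<phi>' p) = s"
    proof
      have "(\<phi>' h - \<phi>' q * \<phi>' p) $ s \<noteq> 0"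
        using h small by simp
      then show "\<phi>' h - \<phi>' q * \<phi>' p \<noteq> 0" by (metis fps_zero_nth)
      show "subdegree (\<phi>' h - \<phi>' q * \<phi>' p) = s"
      proof (rule subdegreeI)
        fix i assume "i < s"
        with h have "\<phi>' h $ i = 0" by (metis nth_less_subdegree_zero)
        with small \<open>i < s\<close> show "(\<phi>' h - \<phi>' q * \<phi>' p) $ i = 0" by simp
      qed fact
    qed
    then have "\<phi> g \<noteq> 0" "subdegree (\<phi> g) = ?n * m + s"
      using X_nonzero by (simp_all add: phi_g germ_mult_eq)
    moreover have "g \<in> order_ideal m"
      by (simp add: order_ideal_iff[of _ _ c] g fps_X_power_mult_nth)
    ultimately show ?thesis by (force simp: orders_def)
  qed
  have "germ.has_quotient_dim UNIV (vanishing_ideal k)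
      (\<Sum>{..m} + card {s \<in> orders \<phi> (order_ideal m). int s < k})"
    using germ.has_quotient_dim_add[OF has_quotient_dim_order_ideal
        composite.has_quotient_dim_count[OF subspace_order_ideal] subspace_order_ideal, of m k] sub
    by (simp add: Int_absorb1)
  moreover have "germ.has_quotient_dim UNIV (vanishing_ideal k) (card {s \<in> orders \<phi> UNIV. int s < k})"
    using composite.has_quotient_dim_count[of UNIV k] by simp
  moreover have "germ.subspace (vanishing_ideal k)"
    using composite.subspace_orders_ge[of UNIV k] by simp
  ultimately have dim: "\<Sum>{..m} + card {s \<in> orders \<phi> (order_ideal m). int s < k} =
      card {s \<in> orders \<phi> UNIV. int s < k}"
    by (rule germ.has_quotient_dim_unique)
  have "card {s \<in> orders \<phi>' UNIV. int s < k - int (?n * m)} =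
      card ((+) (?n * m) ` {s \<in> orders \<phi>' UNIV. int s < k - int (?n * m)})"
    by (rule card_image[symmetric]) simp
  also have "\<dots> \<le> card {s \<in> orders \<phi> (order_ideal m). int s < k}"
  proof (rule card_mono)
    show "finite {s \<in> orders \<phi> (order_ideal m). int s < k}"
      by (rule finite_subset[of _ "{..<nat k}"]) auto
    show "(+) (?n * m) ` {s \<in> orders \<phi>' UNIV. int s < k - int (?n * m)} \<subseteq>
        {s \<in> orders \<phi> (order_ideal m). int s < k}"
      using order by auto
  qed
  finally show ?thesis
    unfolding order_count_def using dim by (intro exI[of _ m]) linarith
qed

end

end


section \<open>Exchanging the variables\<close>

text \<open>
  The chart of the blow-up at the direction \<open>(0 : 1)\<close> is the chart with \<open>c = 0\<close> after exchanging \<open>x\<close>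
  and \<open>y\<close>.
\<close>

definition swap :: "germ \<Rightarrow> germ" where
  "swap f = Abs_fps (\<lambda>i. Abs_fps (\<lambda>j. f $ j $ i))"

lemma swap_nth [simp]: "swap f $ i $ j = f $ j $ i"
  by (simp add: swap_def)

lemma swap_swap [simp]: "swap (swap f) = f"
  by (intro fps_ext) simp

lemma swap_add: "swap (f + g) = swap f + swap g"
  by (intro fps_ext) simp

lemma swap_mult: "swap (f * g) = swap f * swap g"
proof (intro fps_ext)
  show "swap (f * g) $ i $ j = (swap f * swap g) $ i $ j" for i j
    by (simp add: fps_mult_nth fps_sum_nth) (rule sum.swap)
qed

lemma swap_const: "swap (fps_const (fps_const a)) = fps_const (fps_const a)"
  by (intro fps_ext) auto

lemma swap_Y: "swap (fps_const fps_X) = fps_X"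
  by (intro fps_ext) (auto simp: fps_X_def)

lemma swap_power: "swap (f ^ n) = swap f ^ n"
  by (induction n) (use swap_const[of 1] in \<open>simp_all add: swap_mult\<close>)

lemma swap_eq_0_iff [simp]: "swap f = 0 \<longleftrightarrow> f = 0"
  by (metis swap_swap fps_const_0_eq_0 swap_const)

lemma swap_dvd_iff: "swap f dvd g \<longleftrightarrow> f dvd swap g"
  by (metis dvd_def swap_mult swap_swap)

lemma germ_mult_swap: "germ_mult (swap f) = germ_mult f"
proof -
  have "(\<exists>i j. i + j = n \<and> swap f $ i $ j \<noteq> 0) \<longleftrightarrow> (\<exists>i j. i + j = n \<and> f $ i $ j \<noteq> 0)" for n
    by (metis add.commute swap_nth)
  then show ?thesis by (simp add: germ_mult_def)
qed

lemma total_transform_inf_swap: "total_transform_inf f = swap (total_transform 0 (swap f))"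
proof (intro fps_ext)
  fix i k
  have "swap (total_transform 0 (swap f)) $ i $ k = (\<Sum>j\<le>k. if j = i then f $ j $ (k - j) else 0)"
    unfolding swap_nth total_transform_nth fps_sum_nth by (intro sum.cong) (auto simp: fps_X_power_iff)
  then show "total_transform_inf f $ i $ k = swap (total_transform 0 (swap f)) $ i $ k"
    by (simp add: total_transform_inf_def)
qed

lemma (in parametrisation) parametrisation_swap: "parametrisation (\<lambda>g. \<phi> (swap g))"
proof
  obtain N where N: "\<And>u. fps_X ^ N * u \<in> range \<phi>"
    using conductor by blast
  then show "\<exists>N. \<forall>u. fps_X ^ N * u \<in> range (\<lambda>g. \<phi> (swap g))"
    by (metis (no_types, lifting) rangeE rangeI swap_swap)
qed (simp_all add: swap_add swap_mult swap_const add mult const)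

lemma orders_swap: "orders (\<lambda>g. \<phi> (swap g)) UNIV = orders \<phi> UNIV"
proof (intro equalityI subsetI)
  fix s assume "s \<in> orders \<phi> UNIV"
  then obtain g where "\<phi> (swap (swap g)) \<noteq> 0" "s = subdegree (\<phi> (swap (swap g)))"
    by (auto simp: orders_def)
  then show "s \<in> orders (\<lambda>g. \<phi> (swap g)) UNIV"
    unfolding orders_def by blast
qed (auto simp: orders_def)

lemma order_count_swap: "order_count (\<lambda>g. \<phi> (swap g)) = order_count \<phi>"
  by (simp add: order_count_def orders_swap fun_eq_iff)

text \<open>The two halves of \<open>H k = min\<^sub>m (m (m + 1) / 2 + H' (k - n m))\<close>.\<close>

definition blow_up_recursion :: "nat \<Rightarrow> (int \<Rightarrow> int) \<Rightarrow> (int \<Rightarrow> int) \<Rightarrow> bool" where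
  "blow_up_recursion n H H' \<longleftrightarrow>
     (\<forall>k m. H k \<le> int (\<Sum>{..m}) + H' (k - int (n * m))) \<and>
     (\<forall>k. \<exists>m. int (\<Sum>{..m}) + H' (k - int (n * m)) \<le> H k)"

lemma blow_up_step_chart:
  assumes "parametrisation \<psi>" "\<psi> f' = 0" "f \<noteq> 0"
    and "total_transform c f = fps_X ^ germ_mult f * f'"
  shows "\<exists>\<phi>. parametrisation \<phi> \<and> \<phi> f = 0 \<and> ((\<forall>g. \<phi> g = 0 \<longleftrightarrow> f dvd g) \<longrightarrow>
    (\<forall>g. \<psi> g = 0 \<longleftrightarrow> f' dvd g) \<and> blow_up_recursion (germ_mult f) (order_count \<phi>) (order_count \<psi>))"
proof -
  interpret parametrisation \<psi> by fact
  interpret blow_up_chart \<psi> c f f'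
    by unfold_locales (use assms in auto)
  show ?thesis
  proof (intro exI[of _ \<phi>] conjI impI allI)
    assume ker: "\<forall>g. \<phi> g = 0 \<longleftrightarrow> f dvd g"
    show "\<psi> g = 0 \<longleftrightarrow> f' dvd g" for g
      by (rule kernel_transform) (use ker in blast)
    show "blow_up_recursion (germ_mult f) (order_count \<phi>) (order_count \<psi>)"
      unfolding blow_up_recursion_def
    proof (intro conjI allI)
      show "order_count \<phi> k \<le> int (\<Sum>{..m}) + order_count \<psi> (k - int (germ_mult f * m))" for k m
        by (rule order_count_le) (use ker in blast)
      show "\<exists>m. int (\<Sum>{..m}) + order_count \<psi> (k - int (germ_mult f * m)) \<le> order_count \<phi> k" for k
        by (rule order_count_attained) (use ker in blast)
    qed
  qed (fact composite.parametrisation_axioms composite_vanishes)+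
qed

lemma blow_up_step:
  assumes "parametrisation \<psi>" "\<psi> f' = 0" "f \<noteq> 0" and strict: "strict_transform f f'"
  shows "\<exists>\<phi>. parametrisation \<phi> \<and> \<phi> f = 0 \<and> ((\<forall>g. \<phi> g = 0 \<longleftrightarrow> f dvd g) \<longrightarrow>
    (\<forall>g. \<psi> g = 0 \<longleftrightarrow> f' dvd g) \<and> blow_up_recursion (germ_mult f) (order_count \<phi>) (order_count \<psi>))"
proof (cases "\<exists>c. total_transform c f = fps_X ^ germ_mult f * f'")
  case True
  then show ?thesis
    using blow_up_step_chart[OF assms(1-3)] by blast
next
  case False
  then have "total_transform_inf f = fps_const fps_X ^ germ_mult f * f'"
    using strict by (auto simp: strict_transform_def)
  then have "swap (total_transform 0 (swap f)) = fps_const fps_X ^ germ_mult f * f'"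
    by (simp only: total_transform_inf_swap)
  then have "total_transform 0 (swap f) = fps_X ^ germ_mult (swap f) * swap f'"
    by (metis swap_swap swap_mult swap_power swap_Y germ_mult_swap)
  from blow_up_step_chart[OF parametrisation.parametrisation_swap[OF assms(1)] _ _ this]
  obtain \<phi> where \<phi>: "parametrisation \<phi>" "\<phi> (swap f) = 0"
    "(\<forall>g. \<phi> g = 0 \<longleftrightarrow> swap f dvd g) \<longrightarrow> (\<forall>g. \<psi> (swap g) = 0 \<longleftrightarrow> swap f' dvd g) \<and>
      blow_up_recursion (germ_mult f) (order_count \<phi>) (order_count \<psi>)"
    using assms by (auto simp: germ_mult_swap order_count_swap)
  have ker: "(\<forall>g. \<phi> (swap g) = 0 \<longleftrightarrow> f dvd g) \<longleftrightarrow> (\<forall>g. \<phi> g = 0 \<longleftrightarrow> swap f dvd g)"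
    by (metis swap_dvd_iff swap_swap)
  have ker': "(\<forall>g. \<psi> (swap g) = 0 \<longleftrightarrow> swap f' dvd g) \<longleftrightarrow> (\<forall>g. \<psi> g = 0 \<longleftrightarrow> f' dvd g)"
    by (metis swap_dvd_iff swap_swap)
  show ?thesis
  proof (intro exI[of _ "\<lambda>g. \<phi> (swap g)"] conjI)
    show "parametrisation (\<lambda>g. \<phi> (swap g))"
      by (rule parametrisation.parametrisation_swap[OF \<phi>(1)])
    show "\<phi> (swap f) = 0" by fact
    show "(\<forall>g. \<phi> (swap g) = 0 \<longleftrightarrow> f dvd g) \<longrightarrow> (\<forall>g. \<psi> g = 0 \<longleftrightarrow> f' dvd g) \<and>
        blow_up_recursion (germ_mult f) (order_count (\<lambda>g. \<phi> (swap g))) (order_count \<psi>)"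
      using \<phi>(3) unfolding ker ker' order_count_swap .
  qed
qed

section \<open>Smooth germs\<close>

text \<open>The semigroup of a smooth germ consists of all natural numbers.\<close>

definition smooth_count :: "int \<Rightarrow> int" where
  "smooth_count k = max 0 k"

text \<open>
  By the implicit function theorem the germ is a graph \<open>y = y(x)\<close>.  Restriction to it is the remainder
  of Weierstrass division by \<open>f\<close>, a series in \<open>x\<close> alone.
\<close>

lemma smooth_parametrisation_y_regular:
  assumes f: "f $ 0 $ 0 = 0" "f $ 0 $ 1 \<noteq> 0"
  obtains \<phi> where "parametrisation \<phi>" "surj \<phi>" "\<phi> f = 0"
proof -
  have nz: "f $ 0 \<noteq> 0" using f(2) by auto
  have sd: "subdegree (f $ 0) = 1"
    by (rule subdegreeI) (use f in auto)
  have ex: "\<exists>u. f dvd g - from_x u" for g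
  proof -
    obtain q r where g: "g = q * f + r" and r: "\<And>i j. 1 \<le> j \<Longrightarrow> r $ i $ j = 0"
      using weierstrass_division[OF nz, of g] sd by metis
    have "r = from_x (Abs_fps (\<lambda>i. r $ i $ 0))"
      by (intro fps_ext) (use r in \<open>auto simp: Suc_le_eq\<close>)
    then have "f dvd g - from_x (Abs_fps (\<lambda>i. r $ i $ 0))"
      by (simp add: g)
    then show ?thesis by blast
  qed
  have unique: "u = v" if "f dvd g - from_x u" "f dvd g - from_x v" for g u v
  proof -
    have "f dvd from_x u - from_x v"
      using dvd_diff[OF that(2,1)] by simp
    then obtain q where "from_x u - from_x v = f * q" by (auto elim: dvdE)
    then have "(- q) * f + (from_x u - from_x v) = 0" by simp
    from weierstrass_division_unique(2)[OF nz this] sd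
    have "from_x u - from_x v = 0" by (force simp: Suc_le_eq)
    then have "from_x u $ i $ 0 = from_x v $ i $ 0" for i by simp
    then show ?thesis by (simp add: fps_eq_iff)
  qed
  define \<phi> where "\<phi> g = (SOME u. f dvd g - from_x u)" for g
  have \<phi>: "f dvd g - from_x (\<phi> g)" for g
    unfolding \<phi>_def by (rule someI_ex[OF ex])
  have \<phi>_eq: "\<phi> g = u" if "f dvd g - from_x u" for g u
    using unique[OF \<phi> that] .
  have from_x: "\<phi> (from_x u) = u" for u
    by (rule \<phi>_eq) simp
  have "parametrisation \<phi>"
  proof
    fix g h
    show "\<phi> (g + h) = \<phi> g + \<phi> h"
      using dvd_add[OF \<phi>[of g] \<phi>[of h]]
      by (intro \<phi>_eq) (simp add: from_x_add algebra_simps)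
    have "g * h - from_x (\<phi> g * \<phi> h) =
        (g - from_x (\<phi> g)) * h + (h - from_x (\<phi> h)) * from_x (\<phi> g)"
      by (simp add: from_x_mult algebra_simps)
    then show "\<phi> (g * h) = \<phi> g * \<phi> h"
      by (intro \<phi>_eq) (simp add: \<phi>)
  next
    show "\<phi> (fps_const (fps_const a)) = fps_const a" for a
      using from_x[of "fps_const a"] by (simp add: from_x_const)
  next
    show "\<exists>N. \<forall>u. fps_X ^ N * u \<in> range \<phi>"
      by (metis from_x rangeI)
  qed
  moreover have "surj \<phi>" by (metis from_x surjI)
  moreover have "from_x 0 = (0 :: germ)"
    by (rule fps_ext) simp
  then have "\<phi> f = 0"
    by (intro \<phi>_eq) simp
  ultimately show ?thesis by (rule that)
qed

lemma smooth_parametrisation: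
  assumes "f \<noteq> 0" "f $ 0 $ 0 = 0" "germ_mult f = 1"
  obtains \<phi> where "parametrisation \<phi>" "\<phi> f = 0" "order_count \<phi> = smooth_count"
proof -
  obtain i j where "i + j = 1" "f $ i $ j \<noteq> 0"
    using germ_mult_props(2)[OF assms(1)] assms(3) by auto
  then have "f $ 0 $ 1 \<noteq> 0 \<or> f $ 1 $ 0 \<noteq> 0"
    by (cases i) auto
  then have "\<exists>\<phi>. parametrisation \<phi> \<and> surj \<phi> \<and> \<phi> f = 0"
  proof
    assume "f $ 0 $ 1 \<noteq> 0"
    with smooth_parametrisation_y_regular assms show ?thesis by metis
  next
    assume "f $ 1 $ 0 \<noteq> 0"
    then obtain \<phi> where "parametrisation \<phi>" "surj \<phi>" "\<phi> (swap f) = 0"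
      using smooth_parametrisation_y_regular[of "swap f"] assms by auto
    moreover have "surj (\<lambda>g. \<phi> (swap g))"
      using \<open>surj \<phi>\<close> by (metis surj_def swap_swap)
    ultimately show ?thesis
      using parametrisation.parametrisation_swap by blast
  qed
  then obtain \<phi> where \<phi>: "parametrisation \<phi>" "surj \<phi>" "\<phi> f = 0" by blast
  have "s \<in> orders \<phi> UNIV" for s
  proof -
    obtain g where "\<phi> g = fps_X ^ s" using \<phi>(2) by (metis surj_def)
    then show ?thesis by (force simp: orders_def intro!: exI[of _ g])
  qed
  then have "{s \<in> orders \<phi> UNIV. int s < k} = {..<nat k}" for k
    by auto
  then have "order_count \<phi> = smooth_count"
    by (simp add: order_count_def smooth_count_def fun_eq_iff)
  with \<phi> show ?thesis using that by blast
qed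

section \<open>Minimum convolutions\<close>

lemma Inf_int_le_iff:
  fixes S :: "int set"
  assumes "S \<noteq> {}" "\<And>x. x \<in> S \<Longrightarrow> 0 \<le> x"
  shows "Inf S \<le> v \<longleftrightarrow> (\<exists>x\<in>S. x \<le> v)"
proof -
  obtain y where "y \<in> S" using assms(1) by blast
  from ex_has_least_nat[of "\<lambda>x. x \<in> S", OF this, of nat]
  obtain x where x: "x \<in> S" and min: "\<And>y. y \<in> S \<Longrightarrow> nat x \<le> nat y"
    by blast
  have "x \<le> y" if "y \<in> S" for y
    using min[OF that] assms(2)[OF x] assms(2)[OF that] by simp
  then have "Inf S = x" "\<And>y. y \<in> S \<Longrightarrow> x \<le> y"
    using x by (auto intro: cInf_eq_minimum)
  with x show ?thesis by fastforce
qed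

definition nonneg :: "(int \<Rightarrow> int) \<Rightarrow> bool" where
  "nonneg G \<longleftrightarrow> (\<forall>j. 0 \<le> G j)"

text \<open>
  For nonnegative functions the infimum is attained, and a minimum convolution is determined by its
  upper bounds.  Algebraic laws then reduce to manipulations of existential quantifiers.
\<close>

lemma min_conv_le_iff:
  assumes "nonneg G1" "nonneg G2"
  shows "(G1 \<diamondop> G2) j \<le> v \<longleftrightarrow> (\<exists>j1 j2. j1 + j2 = j \<and> G1 j1 + G2 j2 \<le> v)"
proof -
  have "{G1 j1 + G2 j2 |j1 j2. j1 + j2 = j} \<noteq> {}"
    using add_0_right[of j] by blast
  moreover have "0 \<le> x" if "x \<in> {G1 j1 + G2 j2 |j1 j2. j1 + j2 = j}" for x
    using that assms by (auto simp: nonneg_def)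
  ultimately have "Inf {G1 j1 + G2 j2 |j1 j2. j1 + j2 = j} \<le> v \<longleftrightarrow>
      (\<exists>x\<in>{G1 j1 + G2 j2 |j1 j2. j1 + j2 = j}. x \<le> v)"
    by (rule Inf_int_le_iff)
  then show ?thesis
    unfolding min_conv_def by blast
qed

lemma nonneg_min_conv:
  assumes "nonneg G1" "nonneg G2"
  shows "nonneg (G1 \<diamondop> G2)"
  unfolding nonneg_def
proof (rule allI, rule ccontr)
  fix j assume "\<not> 0 \<le> (G1 \<diamondop> G2) j"
  then have "(G1 \<diamondop> G2) j \<le> - 1" by simp
  then obtain j1 j2 where "G1 j1 + G2 j2 \<le> - 1"
    using min_conv_le_iff[OF assms] by blast
  moreover have "0 \<le> G1 j1" "0 \<le> G2 j2"
    using assms by (auto simp: nonneg_def)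
  ultimately show False by simp
qed


lemma eq_via_upper_bounds:
  fixes F G :: "int \<Rightarrow> int"
  assumes "\<And>j v. F j \<le> v \<longleftrightarrow> G j \<le> v"
  shows "F = G"
  using assms by (intro ext order.antisym) auto

lemma min_conv_commute: "G1 \<diamondop> G2 = G2 \<diamondop> G1"
proof
  fix j
  have "{G1 j1 + G2 j2 |j1 j2. j1 + j2 = j} = {G2 j1 + G1 j2 |j1 j2. j1 + j2 = j}"
    by (rule Collect_cong) (metis add.commute)
  then show "(G1 \<diamondop> G2) j = (G2 \<diamondop> G1) j" by (simp add: min_conv_def)
qed

lemma min_conv_assoc:
  assumes "nonneg G1" "nonneg G2" "nonneg G3"
  shows "G1 \<diamondop> G2 \<diamondop> G3 = G1 \<diamondop> (G2 \<diamondop> G3)"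
proof (rule eq_via_upper_bounds)
  fix j v
  have "(G1 \<diamondop> G2 \<diamondop> G3) j \<le> v \<longleftrightarrow> (\<exists>i j3. i + j3 = j \<and> (G1 \<diamondop> G2) i \<le> v - G3 j3)"
    by (simp only: min_conv_le_iff nonneg_min_conv assms le_diff_eq)
  also have "\<dots> \<longleftrightarrow> (\<exists>j1 j2 j3. j1 + j2 + j3 = j \<and> G1 j1 + G2 j2 + G3 j3 \<le> v)"
    unfolding min_conv_le_iff[OF assms(1,2)] unfolding le_diff_eq by blast
  also have "\<dots> \<longleftrightarrow> (\<exists>j1 j2 j3. j1 + (j2 + j3) = j \<and> G2 j2 + G3 j3 + G1 j1 \<le> v)"
    by (simp add: ac_simps)
  also have "\<dots> \<longleftrightarrow> (\<exists>j1 i. j1 + i = j \<and> (G2 \<diamondop> G3) i \<le> v - G1 j1)"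
    unfolding min_conv_le_iff[OF assms(2,3)] unfolding le_diff_eq by blast
  also have "\<dots> \<longleftrightarrow> (G1 \<diamondop> (G2 \<diamondop> G3)) j \<le> v"
    by (simp only: min_conv_le_iff nonneg_min_conv assms le_diff_eq add.commute)
  finally show "(G1 \<diamondop> G2 \<diamondop> G3) j \<le> v \<longleftrightarrow> (G1 \<diamondop> (G2 \<diamondop> G3)) j \<le> v" .
qed

lemma min_conv_left_commute:
  assumes "nonneg G1" "nonneg G2" "nonneg G3"
  shows "G1 \<diamondop> (G2 \<diamondop> G3) = G2 \<diamondop> (G1 \<diamondop> G3)"
  using min_conv_assoc[OF assms(1,2,3)] min_conv_assoc[OF assms(2,1,3)] min_conv_commute[of G1 G2]
  by simp

text \<open>
  The least number of conditions at a point of multiplicity \<open>n\<close> that contribute at least \<open>j\<close> to the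
  intersection multiplicity.
\<close>

definition point_count :: "nat \<Rightarrow> int \<Rightarrow> int" where
  "point_count n j = Inf {int (\<Sum>{..m}) |m. j \<le> int (n * m)}"

lemma point_count_le_iff:
  assumes "0 < n"
  shows "point_count n j \<le> v \<longleftrightarrow> (\<exists>m. j \<le> int (n * m) \<and> int (\<Sum>{..m}) \<le> v)"
proof -
  have "nat j \<le> n * nat j" using assms by simp
  then have "j \<le> int (n * nat j)" by linarith
  then have "{int (\<Sum>{..m}) |m. j \<le> int (n * m)} \<noteq> {}" by blast
  moreover have "0 \<le> x" if "x \<in> {int (\<Sum>{..m}) |m. j \<le> int (n * m)}" for x
    using that of_nat_0_le_iff by blast
  ultimately have "Inf {int (\<Sum>{..m}) |m. j \<le> int (n * m)} \<le> v \<longleftrightarrow>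
      (\<exists>x\<in>{int (\<Sum>{..m}) |m. j \<le> int (n * m)}. x \<le> v)"
    by (rule Inf_int_le_iff)
  then show ?thesis
    unfolding point_count_def by blast
qed

lemma nonneg_point_count: "0 < n \<Longrightarrow> nonneg (point_count n)"
  unfolding nonneg_def
proof (rule allI, rule ccontr)
  fix j assume "0 < n" "\<not> 0 \<le> point_count n j"
  then have "point_count n j \<le> - 1" by simp
  then obtain m where "int (\<Sum>{..m}) \<le> - 1"
    using point_count_le_iff[OF \<open>0 < n\<close>] by blast
  moreover have "0 \<le> int (\<Sum>{..m})" by (rule of_nat_0_le_iff)
  ultimately show False by linarith
qed

text \<open>
  In the convolution the first argument may be any \<open>j1 \<le> n m\<close>; as \<open>H'\<close> is monotone, \<open>j1 = n m\<close> is the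
  best choice.
\<close>

lemma blow_up_recursion_min_conv:
  assumes n: "0 < n" and H': "nonneg H'" "mono H'" and rec: "blow_up_recursion n H H'"
  shows "H = point_count n \<diamondop> H'"
proof (rule eq_via_upper_bounds)
  fix k v
  have "(point_count n \<diamondop> H') k \<le> v \<longleftrightarrow> (\<exists>j1 j2. j1 + j2 = k \<and> point_count n j1 \<le> v - H' j2)"
    by (simp add: min_conv_le_iff nonneg_point_count n H' algebra_simps)
  also have "\<dots> \<longleftrightarrow> (\<exists>j1 j2 m. j1 + j2 = k \<and> j1 \<le> int (n * m) \<and> int (\<Sum>{..m}) + H' j2 \<le> v)"
    unfolding point_count_le_iff[OF n] unfolding le_diff_eq by blast
  also have "\<dots> \<longleftrightarrow> (\<exists>m. int (\<Sum>{..m}) + H' (k - int (n * m)) \<le> v)"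
  proof
    assume "\<exists>j1 j2 m. j1 + j2 = k \<and> j1 \<le> int (n * m) \<and> int (\<Sum>{..m}) + H' j2 \<le> v"
    then obtain j1 j2 m where m: "j1 + j2 = k" "j1 \<le> int (n * m)" "int (\<Sum>{..m}) + H' j2 \<le> v"
      by blast
    then have "H' (k - int (n * m)) \<le> H' j2"
      by (intro monoD[OF H'(2)]) simp
    with m show "\<exists>m. int (\<Sum>{..m}) + H' (k - int (n * m)) \<le> v"
      by (intro exI[of _ m]) linarith
  next
    assume "\<exists>m. int (\<Sum>{..m}) + H' (k - int (n * m)) \<le> v"
    then obtain m where "int (\<Sum>{..m}) + H' (k - int (n * m)) \<le> v" by blast
    then show "\<exists>j1 j2 m. j1 + j2 = k \<and> j1 \<le> int (n * m) \<and> int (\<Sum>{..m}) + H' j2 \<le> v"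
      by (intro exI[of _ "int (n * m)"] exI[of _ "k - int (n * m)"] exI[of _ m]) simp
  qed
  also have "\<dots> \<longleftrightarrow> H k \<le> v"
    using rec unfolding blow_up_recursion_def by (meson order.trans)
  finally show "H k \<le> v \<longleftrightarrow> (point_count n \<diamondop> H') k \<le> v" ..
qed

lemma nonneg_smooth_count: "nonneg smooth_count"
  by (simp add: nonneg_def smooth_count_def)

lemma smooth_count_idem: "smooth_count \<diamondop> smooth_count = smooth_count"
proof (rule eq_via_upper_bounds)
  fix j v
  have "(\<exists>j1 j2. j1 + j2 = j \<and> smooth_count j1 + smooth_count j2 \<le> v) \<longleftrightarrow> smooth_count j \<le> v"
  proof
    assume "smooth_count j \<le> v"
    then show "\<exists>j1 j2. j1 + j2 = j \<and> smooth_count j1 + smooth_count j2 \<le> v"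
      by (intro exI[of _ j] exI[of _ 0]) (simp add: smooth_count_def)
  qed (auto simp: smooth_count_def)
  then show "(smooth_count \<diamondop> smooth_count) j \<le> v \<longleftrightarrow> smooth_count j \<le> v"
    by (simp add: min_conv_le_iff nonneg_smooth_count)
qed

definition sequence_count :: "nat list \<Rightarrow> int \<Rightarrow> int" where
  "sequence_count ns = foldr (\<lambda>n G. point_count n \<diamondop> G) ns smooth_count"

lemma sequence_count_simps [simp]:
  "sequence_count [] = smooth_count"
  "sequence_count (n # ns) = point_count n \<diamondop> sequence_count ns"
  by (simp_all add: sequence_count_def)

lemma nonneg_sequence_count: "\<forall>n\<in>set ns. 0 < n \<Longrightarrow> nonneg (sequence_count ns)"
  by (induction ns) (simp_all add: nonneg_smooth_count nonneg_min_conv nonneg_point_count)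

text \<open>
  The factors \<open>smooth_count\<close> that the germs contribute at the ends of their sequences merge into one.
\<close>

lemma smooth_count_absorbed:
  "\<forall>n\<in>set ns. 0 < n \<Longrightarrow> smooth_count \<diamondop> sequence_count ns = sequence_count ns"
proof (induction ns)
  case (Cons n ns)
  then have "smooth_count \<diamondop> sequence_count (n # ns) =
      point_count n \<diamondop> (smooth_count \<diamondop> sequence_count ns)"
    unfolding sequence_count_simps
    by (intro min_conv_left_commute nonneg_smooth_count nonneg_point_count nonneg_sequence_count) auto
  with Cons show ?case by simp
qed (simp add: smooth_count_idem)

lemma sequence_count_append:
  "\<forall>n\<in>set (ns @ ms). 0 < n \<Longrightarrow> sequence_count ns \<diamondop> sequence_count ms = sequence_count (ns @ ms)"
  by (induction ns)
    (simp_all add: smooth_count_absorbed min_conv_assoc nonneg_point_count nonneg_sequence_count)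

lemma sequence_count_remove1:
  "m \<in> set ns \<Longrightarrow> \<forall>n\<in>set ns. 0 < n \<Longrightarrow>
    sequence_count ns = point_count m \<diamondop> sequence_count (remove1 m ns)"
proof (induction ns)
  case (Cons n ns)
  show ?case
  proof (cases "m = n")
    case False
    with Cons have IH: "sequence_count ns = point_count m \<diamondop> sequence_count (remove1 m ns)" by auto
    have "nonneg (sequence_count (remove1 m ns))"
      using Cons.prems set_remove1_subset[of m ns] by (intro nonneg_sequence_count) auto
    with Cons.prems False IH show ?thesis
      by (simp add: min_conv_left_commute nonneg_point_count)
  qed simp
qed simp

lemma sequence_count_mset_eq:
  "mset ns = mset ms \<Longrightarrow> \<forall>n\<in>set ns. 0 < n \<Longrightarrow> sequence_count ns = sequence_count ms"
proof (induction ns arbitrary: ms)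
  case (Cons n ns)
  have n: "n \<in> set ms" using Cons.prems(1) by (metis list.set_intros(1) mset_eq_setD)
  have pos: "\<forall>n\<in>set ms. 0 < n" using Cons.prems by (metis mset_eq_setD)
  have "mset ns = mset (remove1 n ms)"
    using Cons.prems(1) by (metis add_mset_remove_trivial mset.simps(2) mset_remove1)
  with Cons.IH Cons.prems(2) have "sequence_count ns = sequence_count (remove1 n ms)" by simp
  with sequence_count_remove1[OF n pos] show ?case by simp
qed simp

lemma min_conv_list_sequence_count:
  assumes "nss \<noteq> []" "\<forall>n\<in>set (concat nss). 0 < n"
  shows "min_conv_list (map sequence_count nss) = sequence_count (concat nss)"
proof -
  have fold: "foldl (\<diamondop>) (sequence_count ns) (map sequence_count nss) = sequence_count (ns @ concat nss)"
    if "\<forall>n\<in>set (ns @ concat nss). 0 < n" for ns nss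
    using that
  proof (induction nss arbitrary: ns)
    case (Cons ms nss)
    then have "sequence_count ns \<diamondop> sequence_count ms = sequence_count (ns @ ms)"
      by (intro sequence_count_append) auto
    with Cons.IH[of "ns @ ms"] Cons.prems show ?case by simp
  qed simp
  from assms fold show ?thesis
    by (cases nss) (simp_all add: min_conv_list_def)
qed

section \<open>Counting functions and multiplicity sequences\<close>

lemma nonneg_order_count: "nonneg (order_count \<phi>)"
  by (simp add: nonneg_def order_count_def)

lemma mono_order_count: "mono (order_count \<phi>)"
proof (rule monoI)
  fix j k :: int assume "j \<le> k"
  have "finite {s \<in> orders \<phi> UNIV. int s < k}"
    by (rule finite_subset[of _ "{..<nat k}"]) auto
  then show "order_count \<phi> j \<le> order_count \<phi> k"
    using \<open>j \<le> k\<close> by (auto simp: order_count_def intro!: card_mono)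
qed

lemma strict_transform_nonzero:
  assumes "strict_transform f g" "f \<noteq> 0"
  shows "g \<noteq> 0"
proof
  assume "g = 0"
  with assms have "(\<exists>c. total_transform c f = 0) \<or> total_transform 0 (swap f) = 0"
    by (auto simp: strict_transform_def total_transform_inf_swap)
  moreover have "total_transform c h \<noteq> 0" if "h \<noteq> 0" for c h
    using total_transform_germ_mult[OF that, of c] by fastforce
  ultimately show False using assms(2) by (metis swap_eq_0_iff)
qed

text \<open>
  Parametrisations are built from the last strict transform back to \<open>f\<close>, whereas the knowledge that
  the kernel is generated by the germ is available for \<open>f\<close> and passes to its strict transforms.
  Therefore the statement on the orders is conditional on the kernel.
\<close>

lemma multiplicity_sequence_parametrisation:
  assumes "has_multiplicity_sequence f ns" "f \<noteq> 0" "f $ 0 $ 0 = 0"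
  shows "\<exists>\<phi>. parametrisation \<phi> \<and> \<phi> f = 0 \<and>
    ((\<forall>g. \<phi> g = 0 \<longleftrightarrow> f dvd g) \<longrightarrow> order_count \<phi> = sequence_count ns)"
  using assms
proof (induction ns arbitrary: f)
  case Nil
  then have "germ_mult f = 1"
    by (auto simp: has_multiplicity_sequence_def)
  then obtain \<phi> where "parametrisation \<phi>" "\<phi> f = 0" "order_count \<phi> = smooth_count"
    using smooth_parametrisation Nil.prems by blast
  then show ?case by auto
next
  case (Cons n ns)
  then obtain F where F: "F 0 = f" "\<And>i. strict_transform (F i) (F (Suc i))"
    and mult: "\<And>i. i < length (n # ns) \<Longrightarrow> germ_mult (F i) = (n # ns) ! i \<and> (n # ns) ! i > 1"
    and one: "\<And>i. length (n # ns) \<le> i \<Longrightarrow> germ_mult (F i) = 1"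
    by (auto simp: has_multiplicity_sequence_def)
  have n: "germ_mult f = n" "0 < n"
    using mult[of 0] F by auto
  have strict: "strict_transform f (F 1)"
    using F(2)[of 0] F(1) by simp
  have tail: "has_multiplicity_sequence (F 1) ns"
    unfolding has_multiplicity_sequence_def
  proof (intro exI[of _ "\<lambda>i. F (Suc i)"] conjI allI impI)
    fix i
    show "strict_transform (F (Suc i)) (F (Suc (Suc i)))" by (rule F)
    show "germ_mult (F (Suc i)) = ns ! i" "1 < ns ! i" if "i < length ns"
      using mult[of "Suc i"] that by simp_all
    show "germ_mult (F (Suc i)) = 1" if "length ns \<le> i"
      using one[of "Suc i"] that by simp
  qed simp
  have nonzero: "F 1 \<noteq> 0"
    using strict_transform_nonzero[OF strict] Cons.prems by blast
  have "F 1 $ 0 $ 0 = 0"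
    using strict by (simp add: strict_transform_def)
  from Cons.IH[OF tail nonzero this] obtain \<psi> where \<psi>: "parametrisation \<psi>" "\<psi> (F 1) = 0"
    "(\<forall>g. \<psi> g = 0 \<longleftrightarrow> F 1 dvd g) \<longrightarrow> order_count \<psi> = sequence_count ns"
    by (elim exE conjE)
  obtain \<phi> where \<phi>: "parametrisation \<phi>" "\<phi> f = 0"
    and step: "(\<forall>g. \<phi> g = 0 \<longleftrightarrow> f dvd g) \<longrightarrow> (\<forall>g. \<psi> g = 0 \<longleftrightarrow> F 1 dvd g) \<and>
      blow_up_recursion n (order_count \<phi>) (order_count \<psi>)"
    using blow_up_step[of \<psi> "F 1" f, OF \<psi>(1,2) Cons.prems(2) strict] unfolding n(1) by blast
  have "order_count \<phi> = sequence_count (n # ns)" if "\<forall>g. \<phi> g = 0 \<longleftrightarrow> f dvd g"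
    using blow_up_recursion_min_conv[OF n(2) nonneg_order_count mono_order_count, of "order_count \<phi>" \<psi>]
      \<psi>(3) step that by simp
  with \<phi> show ?case by blast
qed

text \<open>
  As \<open>f\<close> is irreducible and lies in the principal kernel of its parametrisation, it generates the
  kernel.
\<close>

lemma counting_function_eq:
  assumes irr: "irreducible f" and ns: "has_multiplicity_sequence f ns"
  shows "counting_function f = sequence_count ns"
proof -
  have f: "f \<noteq> 0" "\<not> f dvd 1"
    using irr by (auto simp: irreducible_def)
  then have f0: "f $ 0 $ 0 = 0" by (simp add: germ_unit_iff)
  obtain \<phi> where "parametrisation \<phi>" and vanishes: "\<phi> f = 0"
    and count: "(\<forall>g. \<phi> g = 0 \<longleftrightarrow> f dvd g) \<longrightarrow> order_count \<phi> = sequence_count ns"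
    using multiplicity_sequence_parametrisation[OF ns f(1) f0] by blast
  interpret parametrisation \<phi> by fact
  obtain p where p: "\<And>g. \<phi> g = 0 \<longleftrightarrow> p dvd g"
    using kernel_principal[OF f(1) vanishes] by blast
  have "\<not> p dvd 1"
    using p[of 1] by simp
  moreover obtain q where q: "f = p * q"
    using p vanishes by (auto elim: dvdE)
  ultimately have "q dvd 1"
    using irr by (auto simp: irreducible_def)
  with p have ker: "\<phi> g = 0 \<longleftrightarrow> f dvd g" for g
    by (simp add: q mult_unit_dvd)
  then have "counting_function f = order_count \<phi>"
    by (simp add: counting_function_def order_count_def semigroup_of_eq fun_eq_iff)
  with count ker show ?thesis by simp
qed

lemma map_counting_function:
  assumes "\<forall>f\<in>set fs. irreducible f" "list_all2 has_multiplicity_sequence fs ns"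
  shows "map counting_function fs = map sequence_count ns"
    and "\<forall>n\<in>set (concat ns). 0 < n"
proof -
  show "map counting_function fs = map sequence_count ns"
    using assms(2,1) by (induction rule: list_all2_induct) (auto intro: counting_function_eq)
  have "\<forall>n\<in>set ms. 0 < n" if "has_multiplicity_sequence f ms" for f ms
    using that by (force simp: has_multiplicity_sequence_def in_set_conv_nth)
  with assms(2) show "\<forall>n\<in>set (concat ns). 0 < n"
    by (induction rule: list_all2_induct) auto
qed

theorem theorem5p1p3:
  fixes fs gs :: "germ list" and ns ms :: "nat list list"
  assumes "fs \<noteq> []" and "gs \<noteq> []"
    and "\<forall>f \<in> set fs. irreducible f" and "\<forall>g \<in> set gs. irreducible g"
    and "list_all2 has_multiplicity_sequence fs ns"
    and "list_all2 has_multiplicity_sequence gs ms"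
    and "mset (concat ns) = mset (concat ms)"
  shows "min_conv_list (map counting_function fs) = min_conv_list (map counting_function gs)"
proof -
  note f = map_counting_function[OF assms(3,5)] and g = map_counting_function[OF assms(4,6)]
  have "ns \<noteq> []" "ms \<noteq> []"
    using assms by auto
  then have "min_conv_list (map counting_function fs) = sequence_count (concat ns)"
    and "min_conv_list (map counting_function gs) = sequence_count (concat ms)"
    using min_conv_list_sequence_count[OF _ f(2)] min_conv_list_sequence_count[OF _ g(2)] f(1) g(1)
    by simp_all
  moreover have "sequence_count (concat ns) = sequence_count (concat ms)"
    by (rule sequence_count_mset_eq) fact+
  ultimately show ?thesis by simp
qed

end
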